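(* Let $q$ be a power of a prime $p$, $m\ge2$, $1\le k\le q-1$ and $v=k+(m-1)(q-1)$. Then $$\mathrm{PDeg}_q(m,k)=\{\overline{\mathbf d} : \mathbf d\in S^{m+1}(v)\ \text{and}\ \underline{|\mathbf e|}\le k-1\ \text{for all}\ \mathbf e\le_p\eta(\overline{\mathbf d})\}.$$
   Context: $\mathbb P^m=(\mathbb F_q^{m+1}\setminus\{0\})/\mathbb F_q^\times$; the standard representative of a point is the one whose leftmost non-zero coordinate is $1$. $\mathbb F_q[\mathbf X]^H_v$ is the space of homogeneous polynomials of degree $v$ in $X_0,\dots,X_m$ (together with $0$), and $\mathrm{ev}_{\mathbb P^m}(f)=(f(\mathbf P))_{\mathbf P\in\mathbb P^m}$, evaluating at standard representatives. $\mathrm{PRS}_q(k)=\{\mathrm{ev}_{\mathbb P^1}(g): g\in\mathbb F_q[S,T]^H_k\}$. $\mathrm{Emb}_{\mathbb P}(m)$ is the set of injective $\mathbb F_q$-linear maps $L:\mathbb F_q^2\to\mathbb F_q^{m+1}$, and $f\circ L=f(L(S,T))$. For $v=k+(m-1)(q-1)$, $$\mathrm{PLift}_q(m,k)=\{\mathrm{ev}_{\mathbb P^m}(f): f\in\mathbb F_q[\mathbf X]^H_v,\ \forall L\in\mathrm{Emb}_{\mathbb P}(m),\ \mathrm{ev}_{\mathbb P^1}(f\circ L)\in\mathrm{PRS}_q(k)\}.$$ $S^{m+1}(v)=\{\mathbf d\in\mathbb N^{m+1}:\sum_i d_i=v\}$ and $\mathrm{Poly}(D)=\langle\mathbf X^{\mathbf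 d}:\mathbf d\in D\rangle_{\mathbb F_q}$. A tuple $\mathbf d=(d_0,\dots,d_m)$ is $P$-reduced if for every $i$, $d_i\ge q$ implies $d_j=0$ for all $j<i$ and $d_j\le q-1$ for all $j>i$. The $P$-reduction $\overline{\mathbf d}\in S^{m+1}(v)$ of $\mathbf d\in S^{m+1}(v)$ is the $P$-reduced tuple obtained by repeatedly replacing $\mathbf d$ by $\mathbf d+(q-1)(\mathbf e_i-\mathbf e_j)$ for some $i<j$ with $d_i\ge1$ and $d_j\ge q$, until no such move is possible ($\mathbf e_i$ are the canonical basis vectors). $\mathrm{PDeg}_q(m,k)$ is the unique set $D\subseteq S^{m+1}(v)$ of $P$-reduced tuples with $\mathrm{PLift}_q(m,k)=\mathrm{ev}_{\mathbb P^m}(\mathrm{Poly}(D))$ (such a set exists). For a non-negative integer $a$, $\underline a\in\{0,\dots,q-1\}$ is obtained by subtracting $q-1$ from $a$ repeatedly as long as the current value is $\ge q$. For integers, $a\le_p b$ means that each base-$p$ digit of $a$ is at most the corresponding base-$p$ digit of $b$; for tuples, $\le_p$ is coordinatewise. $|\mathbf e|=\sum_i e_i$. For non-zero $\mathbf d=(d_0,\dots,d_m)$, $\iota(\mathbf d)=\min\{i: d_i\ne0\}$ and $\eta(\mathbf d)=(d_{\iota(\mathbf d)+1},\dots,d_m)\in\mathbb N^{m-\iota(\mathbf d)}$ (the empty tuple, of weight $0$, if $\iota(\mathbf d)=m$). *)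

theory Defs
  imports
    Complex_Main
    "HOL-Library.FuncSet"
    "HOL-Library.Cardinality"
    "HOL-Library.Poly_Mapping"
    "HOL-Computational_Algebra.Primes"
begin

text \<open>
  The field with \<open>q\<close> elements is a type \<open>'a\<close> of class \<open>{finite, field}\<close> with \<open>CARD('a) = q\<close>.
  Vectors of length \<open>n\<close> are functions on \<open>nat\<close> vanishing from \<open>n\<close> on. Exponent tuples of length
  \<open>n\<close> are finitely supported maps with keys below \<open>n\<close>. Polynomials are finitely supported maps
  from exponents to coefficients, with the (convolution) ring structure of the library.
\<close>

type_synonym exps = "nat \<Rightarrow>\<^sub>0 nat"
type_synonym 'a mpol = "exps \<Rightarrow>\<^sub>0 'a"

definition vecs :: "nat \<Rightarrow> (nat \<Rightarrow> 'a::zero) set"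
  where "vecs n = {x. \<forall>i\<ge>n. x i = 0}"

definition proj_rel :: "nat \<Rightarrow> ((nat \<Rightarrow> 'a::field) \<times> (nat \<Rightarrow> 'a)) set"
  where "proj_rel m = {(x, y). x \<in> vecs (m + 1) - {\<lambda>_. 0} \<and> y \<in> vecs (m + 1) - {\<lambda>_. 0} \<and>
     (\<exists>c. c \<noteq> 0 \<and> y = (\<lambda>i. c * x i))}"

definition proj_space :: "nat \<Rightarrow> (nat \<Rightarrow> 'a::field) set set"
  where "proj_space m = (vecs (m + 1) - {\<lambda>_. 0}) // proj_rel m"

definition std_rep :: "(nat \<Rightarrow> 'a::field) set \<Rightarrow> nat \<Rightarrow> 'a"
  where "std_rep P = (THE x. x \<in> P \<and> (\<exists>i. x i = 1 \<and> (\<forall>j<i. x j = 0)))"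

definition poly_eval :: "'a::comm_semiring_1 mpol \<Rightarrow> (nat \<Rightarrow> 'a) \<Rightarrow> 'a"
  where "poly_eval f x =
    (\<Sum>d\<in>Poly_Mapping.keys f. Poly_Mapping.lookup f d *
       (\<Prod>i\<in>Poly_Mapping.keys d. x i ^ Poly_Mapping.lookup d i))"

definition ev :: "nat \<Rightarrow> 'a::field mpol \<Rightarrow> (nat \<Rightarrow> 'a) set \<Rightarrow> 'a"
  where "ev m f = restrict (\<lambda>P. poly_eval f (std_rep P)) (proj_space m)"

definition weight :: "exps \<Rightarrow> nat"
  where "weight d = (\<Sum>i\<in>Poly_Mapping.keys d. Poly_Mapping.lookup d i)"

definition simplex :: "nat \<Rightarrow> nat \<Rightarrow> exps set"
  where "simplex n v = {d. Poly_Mapping.keys d \<subseteq> {..<n} \<and> weight d = v}"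

definition hom_polys :: "nat \<Rightarrow> nat \<Rightarrow> 'a::comm_semiring_1 mpol set"
  where "hom_polys m v = {f. Poly_Mapping.keys f \<subseteq> simplex (m + 1) v}"

definition poly_scale :: "'a::comm_semiring_1 \<Rightarrow> 'a mpol \<Rightarrow> 'a mpol"
  where "poly_scale c f = Poly_Mapping.single 0 c * f"

definition Poly :: "exps set \<Rightarrow> 'a::field mpol set"
  where "Poly D = module.span poly_scale ((\<lambda>d. Poly_Mapping.single d 1) ` D)"

definition PRS :: "nat \<Rightarrow> ((nat \<Rightarrow> 'a::field) set \<Rightarrow> 'a) set"
  where "PRS k = ev 1 ` hom_polys 1 k"

definition EmbP :: "nat \<Rightarrow> ((nat \<Rightarrow> 'a::field) \<Rightarrow> (nat \<Rightarrow> 'a)) set"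
  where "EmbP m = {L. L \<in> vecs 2 \<rightarrow> vecs (m + 1) \<and>
     (\<forall>x\<in>vecs 2. \<forall>y\<in>vecs 2. L (\<lambda>i. x i + y i) = (\<lambda>i. L x i + L y i)) \<and>
     (\<forall>c. \<forall>x\<in>vecs 2. L (\<lambda>i. c * x i) = (\<lambda>i. c * L x i)) \<and>
     inj_on L (vecs 2)}"

definition unit_vec :: "nat \<Rightarrow> nat \<Rightarrow> 'a::zero_neq_one"
  where "unit_vec j = (\<lambda>i. if i = j then 1 else 0)"

text \<open>
  Coordinate \<open>i\<close> of \<open>L(S, T)\<close> is the linear form \<open>L(e\<^sub>0)\<^sub>i S + L(e\<^sub>1)\<^sub>i T\<close>; the indeterminates
  \<open>S, T\<close> are numbered \<open>0, 1\<close>.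
\<close>

definition coord_form :: "((nat \<Rightarrow> 'a::field) \<Rightarrow> (nat \<Rightarrow> 'a)) \<Rightarrow> nat \<Rightarrow> 'a mpol"
  where "coord_form L i =
    Poly_Mapping.single (Poly_Mapping.single 0 1) (L (unit_vec 0) i) +
    Poly_Mapping.single (Poly_Mapping.single 1 1) (L (unit_vec 1) i)"

definition poly_comp :: "'a::field mpol \<Rightarrow> ((nat \<Rightarrow> 'a) \<Rightarrow> (nat \<Rightarrow> 'a)) \<Rightarrow> 'a mpol"
  where "poly_comp f L =
    (\<Sum>d\<in>Poly_Mapping.keys f. poly_scale (Poly_Mapping.lookup f d)
       (\<Prod>i\<in>Poly_Mapping.keys d. coord_form L i ^ Poly_Mapping.lookup d i))"

definition PLift :: "nat \<Rightarrow> nat \<Rightarrow> ((nat \<Rightarrow> 'a::{finite, field}) set \<Rightarrow> 'a) set"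
  where "PLift m k =
    {ev m f | f. f \<in> hom_polys m (k + (m - 1) * (CARD('a) - 1)) \<and>
       (\<forall>L\<in>EmbP m. ev 1 (poly_comp f L) \<in> PRS k)}"

definition P_reduced :: "nat \<Rightarrow> exps \<Rightarrow> bool"
  where "P_reduced q d \<longleftrightarrow>
    (\<forall>i. Poly_Mapping.lookup d i \<ge> q \<longrightarrow>
       (\<forall>j<i. Poly_Mapping.lookup d j = 0) \<and> (\<forall>j>i. Poly_Mapping.lookup d j \<le> q - 1))"

text \<open>
  One move \<open>d' = d + (q - 1)(e\<^sub>i - e\<^sub>j)\<close>. For \<open>q > 0\<close>, the condition on \<open>j\<close> puts \<open>j\<close>, hence also
  \<open>i\<close>, among the coordinates of the tuple, so that the length need not be mentioned.
\<close>

definition P_step :: "nat \<Rightarrow> exps \<Rightarrow> exps \<Rightarrow> bool"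
  where "P_step q d d' \<longleftrightarrow>
    (\<exists>i j. i < j \<and> Poly_Mapping.lookup d i \<ge> 1 \<and> Poly_Mapping.lookup d j \<ge> q \<and>
       d' + Poly_Mapping.single j (q - 1) = d + Poly_Mapping.single i (q - 1))"

definition P_reduction :: "nat \<Rightarrow> exps \<Rightarrow> exps"
  where "P_reduction q d = (THE d'. (P_step q)\<^sup>*\<^sup>* d d' \<and> (\<nexists>d''. P_step q d' d''))"

definition PDeg :: "'a::{finite, field} itself \<Rightarrow> nat \<Rightarrow> nat \<Rightarrow> exps set"
  where "PDeg _ m k =
    (THE D. D \<subseteq> simplex (m + 1) (k + (m - 1) * (CARD('a) - 1)) \<and>
       (\<forall>d\<in>D. P_reduced CARD('a) d) \<and>
       (PLift m k :: ((nat \<Rightarrow> 'a) set \<Rightarrow> 'a) set) = ev m ` Poly D)"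

text \<open>The guard \<open>2 \<le> q\<close> only ensures termination.\<close>

fun red :: "nat \<Rightarrow> nat \<Rightarrow> nat"
  where "red q a = (if 2 \<le> q \<and> q \<le> a then red q (a - (q - 1)) else a)"

declare red.simps [simp del]

definition digit_le :: "nat \<Rightarrow> nat \<Rightarrow> nat \<Rightarrow> bool"
  where "digit_le p a b \<longleftrightarrow> (\<forall>r. a div p ^ r mod p \<le> b div p ^ r mod p)"

text \<open>Beyond the length of the tuple \<open>d\<close>, this forces \<open>e\<close> to vanish (for \<open>p \<ge> 2\<close>).\<close>

definition exps_digit_le :: "nat \<Rightarrow> exps \<Rightarrow> exps \<Rightarrow> bool"
  where "exps_digit_le p e d \<longleftrightarrow>
    (\<forall>i. digit_le p (Poly_Mapping.lookup e i) (Poly_Mapping.lookup d i))"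

definition iota :: "exps \<Rightarrow> nat"
  where "iota d = (LEAST i. Poly_Mapping.lookup d i \<noteq> 0)"

text \<open>The coordinates after the leftmost non-zero one, renumbered from \<open>0\<close>.\<close>

definition eta :: "exps \<Rightarrow> exps"
  where "eta d = Poly_Mapping.map_key (\<lambda>i. iota d + 1 + i) d"

end

theory Submission
  imports
    Defs
    "HOL-Computational_Algebra.Polynomial"
    "HOL-Number_Theory.Cong"
begin

text \<open>
  P-reduction does not change the function defined by a monomial, and P-reduced monomials of a
  fixed degree define linearly independent functions. Membership in \<open>PLift\<close> means that
  \<open>f(a S + b T)\<close> is, as a function, a binary form of degree \<open>k\<close>, for all \<open>a, b\<close>: dependent
  \<open>a, b\<close> satisfy this automatically.

  If \<open>d\<close> satisfies the digit condition, change coordinates so that the linear form at \<open>iota d\<close>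
  becomes \<open>S\<close>. By Lucas, only exponents \<open>e\<close> below \<open>eta d\<close> digitwise survive in the expansion of
  the other factors, and \<open>S\<close> to the power \<open>v - |e|\<close> times \<open>T\<close> to the power \<open>|e|\<close> reduces to a
  monomial of degree \<open>k\<close>, since the exponent of \<open>S\<close> stays positive. Conversely, a suitable
  weighted average of \<open>f(a S + b T)\<close> over all \<open>a, b\<close> is a non-zero multiple of a single such
  monomial; that it is a binary form of degree \<open>k\<close> forces the reduction of \<open>|e|\<close> to be less
  than \<open>k\<close>.
\<close>

declare One_nat_def [simp del]

section \<open>Powers in a finite field\<close>

lemma card_field_ge2: "CARD('a::{finite, field}) \<ge> 2"
proof -
  have "card {0, 1 :: 'a} \<le> CARD('a)"
    by (intro card_mono) auto
  thus ?thesis by simp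
qed

text \<open>Multiplication by \<open>x\<close> permutes the non-zero elements, so it fixes their
  product, which can be cancelled.\<close>

lemma field_power_card_minus_1:
  fixes x :: "'a::{finite, field}"
  assumes "x \<noteq> 0"
  shows "x ^ (CARD('a) - 1) = 1"
proof -
  have "(\<Prod>y\<in>UNIV - {0}. x * y) = (\<Prod>y\<in>UNIV - {0}. y)"
    by (rule prod.reindex_bij_witness[of _ "\<lambda>y. y / x" "\<lambda>y. x * y"]) (use assms in auto)
  moreover have "(\<Prod>y\<in>UNIV - {0}. x * y) = x ^ (CARD('a) - 1) * \<Prod>(UNIV - {0})"
    by (simp add: prod.distrib card_Diff_singleton)
  ultimately show ?thesis by simp
qed

text \<open>Non-zero \<open>x\<close> only sees exponents modulo \<open>CARD('a) - 1\<close>. That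
  both exponents vanish together is what \<open>x = 0\<close> requires, as
  \<open>0 ^ 0 = 1\<close>.\<close>

lemma power_eq_if_mod_eq:
  fixes x :: "'a::{finite, field}"
  assumes "i mod (CARD('a) - 1) = j mod (CARD('a) - 1)" "i = 0 \<longleftrightarrow> j = 0"
  shows "x ^ i = x ^ j"
proof (cases "x = 0")
  case False
  have "x ^ n = x ^ (n mod (CARD('a) - 1))" for n
  proof -
    have "x ^ n = (x ^ (CARD('a) - 1)) ^ (n div (CARD('a) - 1)) * x ^ (n mod (CARD('a) - 1))"
      by (simp flip: power_mult power_add)
    thus ?thesis using False by (simp add: field_power_card_minus_1)
  qed
  thus ?thesis using assms by metis
qed (use assms in \<open>auto simp: power_0_left\<close>)

section \<open>Reduction of exponents without changing powers in the field\<close>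

lemma red_less: "2 \<le> q \<Longrightarrow> red q a < q"
  by (induction q a rule: red.induct) (subst red.simps, auto)

lemma red_eq_self: "a < q \<Longrightarrow> red q a = a"
  by (subst red.simps) auto

lemma red_mod: "red q a mod (q - 1) = a mod (q - 1)"
proof (induction q a rule: red.induct)
  case (1 q a)
  show ?case
  proof (cases "2 \<le> q \<and> q \<le> a")
    case True
    hence "red q a mod (q - 1) = (a - (q - 1)) mod (q - 1)"
      using 1 by (subst red.simps) simp
    also have "\<dots> = a mod (q - 1)"
      using True by (metis le_mod_geq le_trans diff_le_self)
    finally show ?thesis .
  qed (subst red.simps, auto)
qed

lemma red_eq_0_iff: "2 \<le> q \<Longrightarrow> red q a = 0 \<longleftrightarrow> a = 0"
  by (induction q a rule: red.induct) (subst red.simps, auto)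

lemma red_eq_iff:
  assumes "2 \<le> q"
  shows "red q a = red q b \<longleftrightarrow> (a = 0 \<longleftrightarrow> b = 0) \<and> a mod (q - 1) = b mod (q - 1)"
proof
  assume "red q a = red q b"
  thus "(a = 0 \<longleftrightarrow> b = 0) \<and> a mod (q - 1) = b mod (q - 1)"
    using red_mod red_eq_0_iff[OF assms] by metis
next
  assume *: "(a = 0 \<longleftrightarrow> b = 0) \<and> a mod (q - 1) = b mod (q - 1)"
  show "red q a = red q b"
  proof (cases "a = 0")
    case False
    hence "red q a \<noteq> 0" "red q b \<noteq> 0"
      using * red_eq_0_iff[OF assms] by auto
    moreover have "red q a < q" "red q b < q"
      using red_less[OF assms] by auto
    moreover have "red q a mod (q - 1) = red q b mod (q - 1)"
      using * by (simp add: red_mod)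
    \<comment> \<open>Residues determine numbers between \<open>1\<close> and \<open>q - 1\<close>;
      residue \<open>0\<close> stands for \<open>q - 1\<close>, because \<open>0\<close> is only the
      reduction of itself.\<close>
    moreover have "x = (if x mod (q - 1) = 0 then q - 1 else x mod (q - 1))"
      if "x \<noteq> 0" "x < q" for x
      using that by (cases "x = q - 1") auto
    ultimately show ?thesis by metis
  qed (use * in auto)
qed

lemma power_red:
  fixes x :: "'a::{finite, field}"
  shows "x ^ red CARD('a) a = x ^ a"
  using red_mod red_eq_0_iff[OF card_field_ge2] by (intro power_eq_if_mod_eq) auto

section \<open>Power sums over the field and a dual basis of the power functions\<close>

text \<open>Otherwise all \<open>CARD('a) - 1\<close> non-zero elements would be roots of a non-zero
  polynomial of degree at most \<open>n\<close>.\<close>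

lemma exists_power_neq_1:
  assumes "0 < n" "n < CARD('a::{finite, field}) - 1"
  shows "\<exists>g::'a. g \<noteq> 0 \<and> g ^ n \<noteq> 1"
proof (rule ccontr)
  assume *: "\<not> ?thesis"
  define P :: "'a poly" where "P = monom 1 n - 1"
  have "coeff P n = 1"
    using assms by (simp add: P_def)
  hence "P \<noteq> 0"
    by auto
  moreover have "degree P \<le> n"
    by (auto simp: P_def intro!: degree_diff_le degree_monom_le)
  ultimately have P: "P \<noteq> 0" "degree P \<le> n" .
  have "card (UNIV - {0::'a}) \<le> card {x. poly P x = 0}"
    using * P by (intro card_mono poly_roots_finite) (auto simp: P_def poly_monom)
  also have "\<dots> \<le> n"
    using card_poly_roots_bound[OF P(1)] P(2) by simp
  finally show False
    using assms by (simp add: card_Diff_singleton)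
qed

lemma of_nat_card_field: "of_nat CARD('a) = (0 :: 'a::{finite, field})"
proof -
  have "(\<Sum>x\<in>UNIV. x + 1) = (\<Sum>x\<in>UNIV. x :: 'a)"
    by (rule sum.reindex_bij_witness[of _ "\<lambda>x. x - 1" "\<lambda>x. x + 1"]) auto
  thus ?thesis by (simp add: sum.distrib)
qed

text \<open>If some non-zero \<open>g\<close> has \<open>g ^ n \<noteq> 1\<close>, substituting
  \<open>g * x\<close> multiplies the sum by \<open>g ^ n\<close>, so it vanishes. Otherwise each
  non-zero \<open>x\<close> contributes \<open>1\<close>; for \<open>n = 0\<close> so does
  \<open>x = 0\<close>, and the total is \<open>CARD('a) = 0\<close>.\<close>

lemma sum_power_field:
  "(\<Sum>x\<in>UNIV. x ^ n) = (if n > 0 \<and> (CARD('a) - 1) dvd n then -1 else 0 :: 'a::{finite, field})"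
proof (cases "n = 0 \<or> (CARD('a) - 1) dvd n")
  case True
  show ?thesis
  proof (cases "n = 0")
    case False
    have "(\<Sum>x\<in>UNIV. x ^ n) = (\<Sum>x\<in>UNIV - {0::'a}. x ^ n)"
      using False by (intro sum.mono_neutral_right) auto
    also have "\<dots> = (\<Sum>x\<in>UNIV - {0::'a}. 1)"
      using True False by (intro sum.cong) (auto simp: field_power_card_minus_1 power_mult elim!: dvdE)
    also have "\<dots> = of_nat (CARD('a) - 1)"
      by (simp add: card_Diff_singleton)
    also have "\<dots> = -1"
      using card_field_ge2[where 'a = 'a] by (simp add: of_nat_diff of_nat_card_field)
    finally show ?thesis using True False by simp
  qed (simp add: of_nat_card_field)
next
  case False
  define r where "r = n mod (CARD('a) - 1)"
  have "0 < r" "r < CARD('a) - 1"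
    using False card_field_ge2[where 'a = 'a] by (auto simp: r_def dvd_eq_mod_eq_0)
  then obtain g :: 'a where g: "g \<noteq> 0" "g ^ r \<noteq> 1"
    using exists_power_neq_1 by blast
  have "g ^ n = g ^ r"
    using \<open>0 < r\<close> False by (intro power_eq_if_mod_eq) (auto simp: r_def)
  have "(\<Sum>x\<in>UNIV. x ^ n) = (\<Sum>x\<in>UNIV. (g * x) ^ n)"
    by (rule sum.reindex_bij_witness[of _ "\<lambda>y. g * y" "\<lambda>y. y / g"]) (use g in auto)
  also have "\<dots> = g ^ n * (\<Sum>x\<in>UNIV. x ^ n)"
    by (simp add: power_mult_distrib sum_distrib_left)
  finally have "(1 - g ^ n) * (\<Sum>x\<in>UNIV. x ^ n) = 0"
    by (simp add: algebra_simps)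
  thus ?thesis using g False by (simp add: \<open>g ^ n = g ^ r\<close>)
qed

text \<open>The basis dual to the functions \<open>x ^ n\<close> with \<open>n < CARD('a)\<close>,
  under summation of products over the field. For \<open>n = 0\<close> the coefficient is read off
  by evaluating at \<open>0\<close>.\<close>

definition dual_weight :: "nat \<Rightarrow> 'a::{finite, field} \<Rightarrow> 'a"
  where "dual_weight n x = (if n = 0 then (if x = 0 then 1 else 0) else - (x ^ (CARD('a) - 1 - n)))"

lemma sum_dual_weight_power:
  assumes "n < CARD('a::{finite, field})"
  shows "(\<Sum>x\<in>UNIV. dual_weight n x * x ^ j) = (if red CARD('a) j = n then 1 else 0 :: 'a)"
proof (cases "n = 0")
  case True
  have "(\<Sum>x\<in>UNIV. dual_weight n x * x ^ j) = (\<Sum>x\<in>{0::'a}. dual_weight n x * x ^ j)"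
    using True by (intro sum.mono_neutral_right) (auto simp: dual_weight_def)
  thus ?thesis
    using True by (simp add: dual_weight_def power_0_left red_eq_0_iff[OF card_field_ge2])
next
  case False
  define q where "q = CARD('a)"
  define r where "r = red q j"
  have r: "r < q" "2 \<le> q"
    using card_field_ge2[where 'a = 'a] by (auto simp: r_def q_def intro: red_less)
  have "(\<Sum>x\<in>UNIV. dual_weight n x * x ^ j) = - (\<Sum>x\<in>(UNIV::'a set). x ^ (q - 1 - n + r))"
    using False by (simp add: dual_weight_def q_def r_def power_red power_add sum_negf)
  also have "\<dots> = (if r = n then 1 else 0)"
  proof -
    \<comment> \<open>As \<open>n\<close> is positive, the exponent is below
      \<open>2 * (q - 1)\<close>, so \<open>q - 1\<close> is the only positive multiple of
      \<open>q - 1\<close> that it can equal.\<close>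
    have "q - 1 - n + r > 0 \<and> (q - 1) dvd (q - 1 - n + r) \<longleftrightarrow> r = n"
    proof
      assume *: "q - 1 - n + r > 0 \<and> (q - 1) dvd (q - 1 - n + r)"
      then obtain c where c: "q - 1 - n + r = (q - 1) * c" by (auto elim!: dvdE)
      have "c \<noteq> 0" using * c by (intro notI) simp
      moreover have "(q - 1) * c < (q - 1) * 2"
        using assms r False unfolding c[symmetric] by (simp add: q_def[symmetric])
      hence "c < 2" by (metis mult_less_cancel1)
      ultimately have "c = 1" by simp
      thus "r = n" using c assms by (simp add: q_def[symmetric])
    qed (use assms r in \<open>auto simp: q_def[symmetric]\<close>)
    thus ?thesis by (simp add: sum_power_field q_def[symmetric])
  qed
  finally show ?thesis by (simp add: r_def q_def)
qed

section \<open>Binomial coefficients modulo a prime\<close>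

text \<open>One step of Lucas: compare coefficients of \<open>X ^ k\<close> in \<open>(1 + X) ^ n =
  ((1 + X) ^ p) ^ (n div p) * (1 + X) ^ (n mod p)\<close>, where
  \<open>(1 + X) ^ p = 1 + X ^ p\<close> in characteristic \<open>p\<close>.\<close>

lemma of_nat_choose_prime_char:
  fixes n k :: nat
  assumes p: "prime p" "CHAR('a::field) = p"
  shows "(of_nat (n choose k) :: 'a) =
    of_nat (n div p choose k div p) * of_nat (n mod p choose k mod p)"
proof -
  have p0: "p > 0" using p prime_gt_0_nat by auto
  define N r where "N = n div p" and "r = n mod p"
  have "[:1, 1:] ^ p = ([:0, 1:] + 1 :: 'a poly) ^ p"
    by (simp add: one_pCons)
  also have "\<dots> = [:0, 1:] ^ p + 1"
    using p by (subst freshmans_dream) auto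
  finally have pow_p: "[:1, 1:] ^ p = monom (1::'a) p + 1"
    by (simp add: monom_altdef)
  have "[:1, 1::'a:] ^ n = ([:1, 1:] ^ p) ^ N * [:1, 1:] ^ r"
    by (simp add: N_def r_def flip: power_mult power_add)
  also have "\<dots> = (\<Sum>i\<le>N. of_nat (N choose i) * monom 1 (p * i) * [:1, 1:] ^ r)"
    by (simp add: pow_p binomial_ring sum_distrib_right monom_power)
  finally have eq: "[:1, 1::'a:] ^ n = (\<Sum>i\<le>N. of_nat (N choose i) * (monom 1 (p * i) * [:1, 1:] ^ r))"
    by (simp add: mult.assoc)
  have coeff_pow: "coeff ([:1, 1::'a:] ^ n) k = of_nat (n choose k)" for n k
  proof (cases "k \<le> n")
    case False
    have "degree ([:1, 1::'a:] ^ n) \<le> n"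
      by (rule order.trans[OF degree_power_le]) simp
    thus ?thesis using False by (simp add: coeff_eq_0 binomial_eq_0)
  qed (simp add: coeff_linear_poly_power)
  have "(of_nat (n choose k) :: 'a) = coeff ([:1, 1:] ^ n) k"
    by (simp add: coeff_pow)
  also have "\<dots> = (\<Sum>i\<le>N. of_nat (N choose i) * (if p * i \<le> k then of_nat (r choose (k - p * i)) else 0))"
    by (auto simp: eq coeff_sum coeff_monom_mult of_nat_poly coeff_pow intro!: sum.cong)
  also have "\<dots> = (\<Sum>i\<in>{..N} \<inter> {k div p}. of_nat (N choose i) * (if p * i \<le> k then of_nat (r choose (k - p * i)) else 0))"
  proof (intro sum.mono_neutral_right ballI)
    fix i assume "i \<in> {..N} - {..N} \<inter> {k div p}"
    hence i: "i \<noteq> k div p" by auto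
    \<comment> \<open>Only \<open>i = k div p\<close> contributes: for smaller \<open>i\<close> the
      lower index \<open>k - p * i\<close> is at least \<open>p\<close>, hence exceeds
      \<open>r\<close>.\<close>
    have "r < k - p * i" if "p * i \<le> k"
    proof -
      have "i < k div p"
        using i that p0 by (metis less_eq_div_iff_mult_less_eq mult.commute le_neq_implies_less)
      hence "p * Suc i \<le> k"
        using p0 by (metis Suc_leI less_eq_div_iff_mult_less_eq mult.commute)
      moreover have "r < p" using p0 by (simp add: r_def)
      ultimately show ?thesis by simp
    qed
    thus "(of_nat (N choose i) :: 'a) * (if p * i \<le> k then of_nat (r choose (k - p * i)) else 0) = 0"
      by (auto simp: binomial_eq_0)
  qed auto
  also have "\<dots> = of_nat (N choose (k div p)) * of_nat (r choose (k mod p))"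
    by (cases "k div p \<le> N") (auto simp: minus_mult_div_eq_mod binomial_eq_0)
  finally show ?thesis by (simp add: N_def r_def)
qed

lemma digit_le_rec:
  "digit_le p k n \<longleftrightarrow> k mod p \<le> n mod p \<and> digit_le p (k div p) (n div p)"
proof -
  have "(\<forall>r. P r) \<longleftrightarrow> P 0 \<and> (\<forall>r. P (Suc r))" for P :: "nat \<Rightarrow> bool"
    by (metis not0_implies_Suc)
  from this[of "\<lambda>r. k div p ^ r mod p \<le> n div p ^ r mod p"] show ?thesis
    by (simp add: digit_le_def div_mult2_eq)
qed

lemma digit_le_imp_le: "2 \<le> p \<Longrightarrow> digit_le p k n \<Longrightarrow> k \<le> n"
proof (induction k arbitrary: n rule: less_induct)
  case (less k)
  show ?case
  proof (cases "k = 0")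
    case False
    have *: "k mod p \<le> n mod p" "digit_le p (k div p) (n div p)"
      using less.prems digit_le_rec[of p k n] by auto
    have "k div p \<le> n div p"
      using less False * by simp
    hence "k div p * p + k mod p \<le> n div p * p + n mod p"
      using * by (intro add_mono mult_right_mono) auto
    thus ?thesis by simp
  qed simp
qed

text \<open>Lucas, by splitting off the lowest digit. For a single digit the binomial coefficient
  divides the factorial of a number below \<open>p\<close>, which is prime to
  \<open>p\<close>.\<close>

lemma of_nat_choose_neq_0_iff_digit_le:
  assumes p: "prime p" "CHAR('a::field) = p"
  shows "(of_nat (n choose k) :: 'a) \<noteq> 0 \<longleftrightarrow> digit_le p k n"
proof (induction n arbitrary: k rule: less_induct)
  case (less n)
  have p2: "2 \<le> p" using p prime_ge_2_nat by auto
  show ?case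
  proof (cases "n = 0")
    case True
    have "digit_le p k 0 \<longleftrightarrow> k = 0"
      using digit_le_imp_le[OF p2, of k 0] by (auto simp: digit_le_def)
    thus ?thesis using True by (cases k) auto
  next
    case False
    have digit: "(of_nat (n mod p choose k mod p) :: 'a) \<noteq> 0 \<longleftrightarrow> k mod p \<le> n mod p"
    proof
      assume le: "k mod p \<le> n mod p"
      have "\<not> p dvd fact (n mod p)"
        using p p2 by (simp add: prime_dvd_fact_iff not_le)
      moreover have "(n mod p choose k mod p) dvd fact (n mod p)"
        using binomial_fact_lemma[OF le] by (metis dvd_triv_right)
      ultimately show "(of_nat (n mod p choose k mod p) :: 'a) \<noteq> 0"
        using p(2) by (auto simp: of_nat_eq_0_iff_char_dvd dest: dvd_trans)
    qed (metis binomial_eq_0 not_le of_nat_0)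
    have "n div p < n" using False p2 by simp
    from less[OF this, of "k div p"] show ?thesis
      by (subst digit_le_rec, subst of_nat_choose_prime_char[OF p]) (use digit in auto)
  qed
qed

text \<open>The size of the field is zero in the field, so the prime \<open>CHAR('a)\<close> divides
  \<open>p ^ s\<close>.\<close>

lemma CHAR_eq_prime:
  assumes "prime p" "CARD('a::{finite, field}) = p ^ s"
  shows "CHAR('a) = p"
proof -
  have "prime CHAR('a)"
    by (intro prime_CHAR_semidom finite_imp_CHAR_pos) simp
  moreover have "CHAR('a) dvd p ^ s"
    using of_nat_card_field[where 'a = 'a] unfolding assms(2) of_nat_eq_0_iff_char_dvd .
  ultimately show ?thesis
    using assms(1) prime_dvd_power_nat primes_dvd_imp_eq by blast
qed

section \<open>Binary forms as functions\<close>

text \<open>Forms are taken as functions of two field elements, because codewords only record values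
  and several polynomials may have the same values.\<close>

definition binary_forms :: "nat \<Rightarrow> ('a::comm_ring_1 \<Rightarrow> 'a \<Rightarrow> 'a) set"
  where "binary_forms k = {G. \<exists>c. \<forall>s t. G s t = (\<Sum>i\<le>k. c i * s ^ i * t ^ (k - i))}"

lemma binary_forms_add:
  assumes "F \<in> binary_forms k" "G \<in> binary_forms k"
  shows "(\<lambda>s t. F s t + G s t) \<in> binary_forms k"
proof -
  from assms obtain c d where
    "\<And>s t. F s t = (\<Sum>i\<le>k. c i * s ^ i * t ^ (k - i))"
    "\<And>s t. G s t = (\<Sum>i\<le>k. d i * s ^ i * t ^ (k - i))"
    unfolding binary_forms_def by blast
  hence "\<forall>s t. F s t + G s t = (\<Sum>i\<le>k. (c i + d i) * s ^ i * t ^ (k - i))"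
    by (simp add: sum.distrib distrib_right)
  thus ?thesis unfolding binary_forms_def mem_Collect_eq by (intro exI[of _ "\<lambda>i. c i + d i"])
qed

lemma binary_forms_scale:
  assumes "F \<in> binary_forms k"
  shows "(\<lambda>s t. a * F s t) \<in> binary_forms k"
proof -
  from assms obtain c where "\<And>s t. F s t = (\<Sum>i\<le>k. c i * s ^ i * t ^ (k - i))"
    unfolding binary_forms_def by blast
  hence "\<forall>s t. a * F s t = (\<Sum>i\<le>k. (a * c i) * s ^ i * t ^ (k - i))"
    by (simp add: sum_distrib_left mult.assoc)
  thus ?thesis unfolding binary_forms_def mem_Collect_eq by (intro exI[of _ "\<lambda>i. a * c i"])
qed

lemma binary_forms_0: "(\<lambda>s t. 0) \<in> binary_forms k"
  unfolding binary_forms_def by (auto intro!: exI[of _ "\<lambda>_. 0"])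

lemma binary_forms_sum:
  "(\<And>x. x \<in> A \<Longrightarrow> F x \<in> binary_forms k) \<Longrightarrow> (\<lambda>s t. \<Sum>x\<in>A. F x s t) \<in> binary_forms k"
  by (induction A rule: infinite_finite_induct) (auto intro: binary_forms_0 binary_forms_add)

lemma binary_forms_monom:
  assumes "i + j = k"
  shows "(\<lambda>s t. s ^ i * t ^ j) \<in> binary_forms k"
proof -
  have "s ^ i * t ^ j = (\<Sum>l\<le>k. (if l = i then 1 else 0) * s ^ l * t ^ (k - l))" for s t :: 'a
    using assms by (subst sum.mono_neutral_cong_right[of _ "{i}"]) auto
  thus ?thesis unfolding binary_forms_def mem_Collect_eq by (intro exI[of _ "\<lambda>l. if l = i then 1 else 0"]) simp
qed

lemma binary_forms_eqI:
  assumes "F \<in> binary_forms k"  "\<And>s t. G s t = F s t"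
  shows "G \<in> binary_forms k"
proof -
  have "G = F" using assms(2) by (intro ext)
  thus ?thesis using assms(1) by simp
qed

lemma binary_forms_mult:
  assumes "F \<in> binary_forms k" "G \<in> binary_forms l"
  shows "(\<lambda>s t. F s t * G s t) \<in> binary_forms (k + l)"
proof -
  from assms obtain c d where cd:
    "\<And>s t. F s t = (\<Sum>i\<le>k. c i * s ^ i * t ^ (k - i))"
    "\<And>s t. G s t = (\<Sum>j\<le>l. d j * s ^ j * t ^ (l - j))"
    unfolding binary_forms_def by blast
  have "(\<lambda>s t. \<Sum>i\<le>k. \<Sum>j\<le>l. (c i * d j) * (s ^ (i + j) * t ^ ((k - i) + (l - j)))) \<in> binary_forms (k + l)"
    by (intro binary_forms_sum binary_forms_scale binary_forms_monom) auto
  thus ?thesis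
    by (rule binary_forms_eqI) (simp only: cd sum_product power_add mult_ac)
qed

lemma binary_forms_linear: "(\<lambda>s t. a * s + b * t) \<in> binary_forms 1"
  using binary_forms_add[OF binary_forms_scale[OF binary_forms_monom[of 1 0 1], of a]
      binary_forms_scale[OF binary_forms_monom[of 0 1 1], of b]] by simp

lemma binary_forms_power:
  "F \<in> binary_forms k \<Longrightarrow> (\<lambda>s t. F s t ^ n) \<in> binary_forms (n * k)"
proof (induction n)
  case 0
  show ?case using binary_forms_monom[of 0 0 0] by simp
next
  case (Suc n)
  thus ?case using binary_forms_mult[of F k "\<lambda>s t. F s t ^ n" "n * k"] by simp
qed

text \<open>Serves to undo a change of parameters on a line.\<close>

lemma binary_forms_compose_linear:
  assumes "G \<in> binary_forms k"
  shows "(\<lambda>s t. G (a * s + b * t) (c * s + d * t)) \<in> binary_forms k"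
proof -
  from assms obtain g where g: "\<And>s t. G s t = (\<Sum>i\<le>k. g i * s ^ i * t ^ (k - i))"
    unfolding binary_forms_def by blast
  have "(\<lambda>s t. (a * s + b * t) ^ i * (c * s + d * t) ^ (k - i)) \<in> binary_forms k" if "i \<le> k" for i
    using binary_forms_mult[OF binary_forms_power[OF binary_forms_linear[of a b], of i]
        binary_forms_power[OF binary_forms_linear[of c d], of "k - i"]] that by simp
  hence "(\<lambda>s t. \<Sum>i\<le>k. g i * ((a * s + b * t) ^ i * (c * s + d * t) ^ (k - i))) \<in> binary_forms k"
    by (intro binary_forms_sum binary_forms_scale) auto
  thus ?thesis
    by (rule binary_forms_eqI) (simp add: g mult.assoc)
qed

text \<open>The functional \<open>\<Lambda>\<close> adds up the coefficients of all monomials whose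
  exponents reduce to those of \<open>i\<close> and \<open>j\<close>. It is non-zero on the given
  monomial, so the form has a term with exponents \<open>l\<close>, \<open>k - l\<close> of this
  kind, and \<open>k < CARD('a)\<close> makes both of them their own reductions.\<close>

lemma monom_in_binary_formsD:
  fixes c :: "'a::{finite, field}"
  assumes "(\<lambda>s t. c * (s ^ i * t ^ j)) \<in> binary_forms k" "k < CARD('a)" "c \<noteq> 0"
  shows "red CARD('a) i + red CARD('a) j = k"
proof -
  define q where "q = CARD('a)"
  define \<Lambda> :: "('a \<Rightarrow> 'a \<Rightarrow> 'a) \<Rightarrow> 'a" where
    "\<Lambda> F = (\<Sum>s\<in>UNIV. \<Sum>t\<in>UNIV. dual_weight (red q i) s * dual_weight (red q j) t * F s t)" for F
  have red: "red q n < q" for n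
    using card_field_ge2[where 'a = 'a] by (simp add: q_def red_less)
  have \<Lambda>: "\<Lambda> (\<lambda>s t. c * (s ^ i' * t ^ j')) =
      (if red q i' = red q i \<and> red q j' = red q j then c else 0)" for i' j' c
  proof -
    have "\<Lambda> (\<lambda>s t. c * (s ^ i' * t ^ j')) =
        c * ((\<Sum>s\<in>UNIV. dual_weight (red q i) s * s ^ i') * (\<Sum>t\<in>UNIV. dual_weight (red q j) t * t ^ j'))"
      unfolding \<Lambda>_def sum_product unfolding sum_distrib_left by (intro sum.cong) auto
    thus ?thesis
      using sum_dual_weight_power[where 'a = 'a] red by (simp add: q_def)
  qed
  obtain d where d: "\<And>s t. c * (s ^ i * t ^ j) = (\<Sum>l\<le>k. d l * s ^ l * t ^ (k - l))"
    using assms(1) unfolding binary_forms_def by blast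
  have "c = \<Lambda> (\<lambda>s t. c * (s ^ i * t ^ j))"
    by (simp add: \<Lambda>)
  also have "\<dots> = (\<Sum>s\<in>UNIV. \<Sum>t\<in>UNIV. \<Sum>l\<le>k.
      dual_weight (red q i) s * dual_weight (red q j) t * (d l * (s ^ l * t ^ (k - l))))"
    unfolding d \<Lambda>_def by (simp only: sum_distrib_left mult.assoc)
  also have "\<dots> = (\<Sum>s\<in>UNIV. \<Sum>l\<le>k. \<Sum>t\<in>UNIV.
      dual_weight (red q i) s * dual_weight (red q j) t * (d l * (s ^ l * t ^ (k - l))))"
    by (intro sum.cong refl sum.swap)
  also have "\<dots> = (\<Sum>l\<le>k. \<Lambda> (\<lambda>s t. d l * (s ^ l * t ^ (k - l))))"
    unfolding \<Lambda>_def by (rule sum.swap)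
  finally have c: "c = (\<Sum>l\<le>k. if red q l = red q i \<and> red q (k - l) = red q j then d l else 0)"
    unfolding \<Lambda> .
  have "\<exists>l\<le>k. red q l = red q i \<and> red q (k - l) = red q j"
  proof (rule ccontr)
    assume "\<not> ?thesis"
    hence "c = 0" unfolding c by (intro sum.neutral) auto
    thus False using assms(3) by simp
  qed
  thus ?thesis
    using assms(2) by (auto simp: q_def red_eq_self)
qed

section \<open>Evaluation of polynomials\<close>

definition monom_eval :: "exps \<Rightarrow> (nat \<Rightarrow> 'a::comm_semiring_1) \<Rightarrow> 'a"
  where "monom_eval d x = (\<Prod>i\<in>Poly_Mapping.keys d. x i ^ Poly_Mapping.lookup d i)"

lemma monom_eval_superset:
  assumes "finite A" "Poly_Mapping.keys d \<subseteq> A"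
  shows "monom_eval d x = (\<Prod>i\<in>A. x i ^ Poly_Mapping.lookup d i)"
  unfolding monom_eval_def using assms
  by (intro prod.mono_neutral_left) (auto simp: in_keys_iff)

lemma poly_eval_superset:
  assumes "finite A" "Poly_Mapping.keys f \<subseteq> A"
  shows "poly_eval f x = (\<Sum>d\<in>A. Poly_Mapping.lookup f d * monom_eval d x)"
  unfolding poly_eval_def monom_eval_def[symmetric] using assms
  by (intro sum.mono_neutral_left) (auto simp: in_keys_iff)

lemmas poly_eval_keys = poly_eval_superset[OF finite_keys order.refl]

lemma monom_eval_add: "monom_eval (d + e) x = monom_eval d x * monom_eval e x"
proof -
  define A where "A = Poly_Mapping.keys d \<union> Poly_Mapping.keys e"
  have "finite A" "Poly_Mapping.keys d \<subseteq> A" "Poly_Mapping.keys e \<subseteq> A" "Poly_Mapping.keys (d + e) \<subseteq> A"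
    using keys_add[of d e] by (auto simp: A_def)
  thus ?thesis
    by (simp add: monom_eval_superset[of A] lookup_add power_add prod.distrib)
qed

lemma poly_eval_single: "poly_eval (Poly_Mapping.single d c) x = c * monom_eval d x"
  by (simp add: poly_eval_superset[of "{d}"])

lemma poly_eval_add: "poly_eval (f + g) x = poly_eval f x + poly_eval g x"
proof -
  define A where "A = Poly_Mapping.keys f \<union> Poly_Mapping.keys g"
  have "finite A" "Poly_Mapping.keys f \<subseteq> A" "Poly_Mapping.keys g \<subseteq> A" "Poly_Mapping.keys (f + g) \<subseteq> A"
    using keys_add[of f g] by (auto simp: A_def)
  thus ?thesis
    by (simp add: poly_eval_superset[of A] lookup_add distrib_right sum.distrib)
qed

lemma poly_eval_0: "poly_eval 0 x = 0"
  by (simp add: poly_eval_def)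

lemma poly_eval_sum: "poly_eval (sum f A) x = (\<Sum>a\<in>A. poly_eval (f a) x)"
  by (induction A rule: infinite_finite_induct) (auto simp: poly_eval_0 poly_eval_add)

lemma poly_mapping_sum_single:
  "f = (\<Sum>d\<in>Poly_Mapping.keys f. Poly_Mapping.single d (Poly_Mapping.lookup f d))"
proof (rule poly_mapping_eqI)
  fix e
  have "(\<Sum>d\<in>Poly_Mapping.keys f. Poly_Mapping.lookup (Poly_Mapping.single d (Poly_Mapping.lookup f d)) e)
      = (\<Sum>d\<in>Poly_Mapping.keys f. if d = e then Poly_Mapping.lookup f e else 0)"
    by (intro sum.cong) (auto simp: lookup_single when_def)
  thus "Poly_Mapping.lookup f e = Poly_Mapping.lookup
      (\<Sum>d\<in>Poly_Mapping.keys f. Poly_Mapping.single d (Poly_Mapping.lookup f d)) e"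
    by (simp add: lookup_sum in_keys_iff)
qed

text \<open>Bilinearity reduces the convolution product to products of monomials.\<close>

lemma poly_eval_mult: "poly_eval (f * g) x = poly_eval f x * poly_eval g x"
proof -
  have "f * g = (\<Sum>d\<in>Poly_Mapping.keys f. \<Sum>e\<in>Poly_Mapping.keys g.
      Poly_Mapping.single (d + e) (Poly_Mapping.lookup f d * Poly_Mapping.lookup g e))"
    by (subst poly_mapping_sum_single[of f], subst poly_mapping_sum_single[of g])
       (simp add: sum_product mult_single)
  thus ?thesis
    by (simp add: poly_eval_sum poly_eval_single monom_eval_add poly_eval_keys[of f]
        poly_eval_keys[of g] sum_product mult_ac)
qed

lemma poly_eval_1: "poly_eval 1 x = 1"
  using poly_eval_single[of 0 1 x] by (simp add: monom_eval_def)

lemma poly_eval_power: "poly_eval (f ^ n) x = poly_eval f x ^ n"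
  by (induction n) (auto simp: poly_eval_1 poly_eval_mult)

lemma poly_eval_prod: "poly_eval (prod f A) x = (\<Prod>a\<in>A. poly_eval (f a) x)"
  by (induction A rule: infinite_finite_induct) (auto simp: poly_eval_1 poly_eval_mult)

lemma poly_eval_scale: "poly_eval (poly_scale c f) x = c * poly_eval f x"
  by (simp add: poly_scale_def poly_eval_mult poly_eval_single monom_eval_def)

lemma poly_eval_coord_form:
  "poly_eval (coord_form L i) x = L (unit_vec 0) i * x 0 + L (unit_vec 1) i * x 1"
  by (simp add: coord_form_def poly_eval_add poly_eval_single monom_eval_def)

lemma poly_eval_comp:
  "poly_eval (poly_comp f L) x =
    poly_eval f (\<lambda>i. L (unit_vec 0) i * x 0 + L (unit_vec 1) i * x 1)"
  unfolding poly_comp_def poly_eval_sum poly_eval_scale poly_eval_prod poly_eval_power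
    poly_eval_coord_form poly_eval_keys[of f] monom_eval_def by (rule refl)

lemma lookup_poly_scale:
  "Poly_Mapping.lookup (poly_scale c f) d = c * Poly_Mapping.lookup f d"
  unfolding poly_scale_def mult_map_scale_conv_mult[symmetric]
  by (simp add: Poly_Mapping.map.rep_eq when_def)

text \<open>Replaces the span by a condition on supports, the form in which it is used
  below.\<close>

lemma Poly_eq: "Defs.Poly D = {f :: 'a::field mpol. Poly_Mapping.keys f \<subseteq> D}"
proof -
  interpret module "poly_scale :: 'a \<Rightarrow> 'a mpol \<Rightarrow> 'a mpol"
    by standard (rule poly_mapping_eqI; simp add: lookup_poly_scale lookup_add algebra_simps)+
  show ?thesis unfolding Defs.Poly_def
  proof (rule span_subspace)
    show "(\<lambda>d. Poly_Mapping.single d 1) ` D \<subseteq> {f :: 'a mpol. Poly_Mapping.keys f \<subseteq> D}"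
      by auto
    show "subspace {f :: 'a mpol. Poly_Mapping.keys f \<subseteq> D}"
      unfolding subspace_def
    proof (intro conjI ballI allI)
      fix f g :: "'a mpol" and c
      assume "f \<in> {f. Poly_Mapping.keys f \<subseteq> D}"
      thus "poly_scale c f \<in> {f. Poly_Mapping.keys f \<subseteq> D}"
        by (auto simp: in_keys_iff lookup_poly_scale)
      assume "g \<in> {f. Poly_Mapping.keys f \<subseteq> D}"
      with \<open>f \<in> _\<close> show "f + g \<in> {f. Poly_Mapping.keys f \<subseteq> D}"
        using keys_add[of f g] by auto
    qed auto
    show "{f. Poly_Mapping.keys f \<subseteq> D} \<subseteq> span ((\<lambda>d. Poly_Mapping.single d 1) ` D)"
    proof
      fix f :: "'a mpol" assume f: "f \<in> {f. Poly_Mapping.keys f \<subseteq> D}"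
      have "(\<Sum>d\<in>Poly_Mapping.keys f. poly_scale (Poly_Mapping.lookup f d) (Poly_Mapping.single d 1))
          \<in> span ((\<lambda>d. Poly_Mapping.single d 1) ` D)"
        using f by (intro span_sum span_scale span_base) auto
      also have "(\<Sum>d\<in>Poly_Mapping.keys f. poly_scale (Poly_Mapping.lookup f d) (Poly_Mapping.single d 1)) = f"
        by (simp add: poly_scale_def mult_single flip: poly_mapping_sum_single)
      finally show "f \<in> span ((\<lambda>d. Poly_Mapping.single d 1) ` D)" .
    qed
  qed
qed

lemma poly_eval_diff:
  fixes f g :: "'a::comm_ring_1 mpol"
  shows "poly_eval (f - g) x = poly_eval f x - poly_eval g x"
  using poly_eval_add[of "f - g" g x] by simp

lemma weight_superset:
  assumes "finite A" "Poly_Mapping.keys d \<subseteq> A"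
  shows "weight d = (\<Sum>i\<in>A. Poly_Mapping.lookup d i)"
  unfolding weight_def using assms by (intro sum.mono_neutral_left) (auto simp: in_keys_iff)

lemma monom_eval_homogeneous: "monom_eval d (\<lambda>i. c * x i) = c ^ weight d * monom_eval d x"
  unfolding monom_eval_def weight_def power_mult_distrib prod.distrib power_sum by (rule refl)

lemma poly_eval_homogeneous:
  assumes "f \<in> hom_polys m v"
  shows "poly_eval f (\<lambda>i. c * x i) = c ^ v * poly_eval f x"
proof -
  have "weight d = v" if "d \<in> Poly_Mapping.keys f" for d
    using that assms by (auto simp: hom_polys_def simplex_def)
  thus ?thesis
    by (simp add: poly_eval_keys[of f] monom_eval_homogeneous sum_distrib_left mult_ac)
qed

lemma poly_eval_homogeneous_0:
  assumes "f \<in> hom_polys m v" "0 < v"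
  shows "poly_eval f (\<lambda>_. 0) = 0"
  using poly_eval_homogeneous[OF assms(1), of 0 "\<lambda>_. 0"] assms(2) by (simp add: zero_power)

lemma poly_eval_cong:
  assumes "f \<in> hom_polys m v" "\<And>i. i \<le> m \<Longrightarrow> x i = y i"
  shows "poly_eval f x = poly_eval f y"
  unfolding poly_eval_keys[of f] monom_eval_def
proof (intro sum.cong prod.cong arg_cong2[where f = "(*)"] arg_cong2[where f = "(^)"] refl)
  fix d i assume "d \<in> Poly_Mapping.keys f" "i \<in> Poly_Mapping.keys d"
  thus "x i = y i"
    using assms by (fastforce simp: hom_polys_def simplex_def)
qed

section \<open>Projective points\<close>

text \<open>Divide by the leftmost non-zero coordinate. Any other candidate in the class has the
  same leftmost position, which makes the definite description in \<open>std_rep\<close>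
  unique.\<close>

lemma std_rep_class:
  fixes x :: "nat \<Rightarrow> 'a::field"
  assumes "x \<in> vecs (m + 1) - {\<lambda>_. 0}"
  obtains c where "c \<noteq> 0" "std_rep (proj_rel m `` {x}) = (\<lambda>i. c * x i)"
proof -
  define i where "i = (LEAST i. x i \<noteq> 0)"
  obtain i0 where "x i0 \<noteq> 0" using assms by auto
  hence xi: "x i \<noteq> 0" unfolding i_def by (rule LeastI)
  have less: "x j = 0" if "j < i" for j
    using not_less_Least that unfolding i_def by blast
  have "std_rep (proj_rel m `` {x}) = (\<lambda>j. 1 / x i * x j)"
    unfolding std_rep_def
  proof (rule the_equality)
    have "(\<lambda>j. 1 / x i * x j) \<noteq> (\<lambda>_. 0)"
      using xi by (auto simp: fun_eq_iff)
    hence "(\<lambda>j. 1 / x i * x j) \<in> proj_rel m `` {x}"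
      using assms xi by (auto simp: proj_rel_def vecs_def intro!: exI[of _ "1 / x i"])
    moreover have "1 / x i * x i = 1 \<and> (\<forall>j<i. 1 / x i * x j = 0)"
      using xi less by auto
    ultimately show "(\<lambda>j. 1 / x i * x j) \<in> proj_rel m `` {x} \<and>
        (\<exists>i'. 1 / x i * x i' = 1 \<and> (\<forall>j<i'. 1 / x i * x j = 0))"
      by blast
  next
    fix y assume "y \<in> proj_rel m `` {x} \<and> (\<exists>i'. y i' = 1 \<and> (\<forall>j<i'. y j = 0))"
    then obtain c i' where *: "c \<noteq> 0" "y = (\<lambda>j. c * x j)" "y i' = 1" "\<forall>j<i'. y j = 0"
      by (auto simp: proj_rel_def)
    have "\<not> i' < i" using less[of i'] * by auto
    moreover have "\<not> i < i'" using xi * by auto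
    ultimately have "i' = i" by simp
    thus "y = (\<lambda>j. 1 / x i * x j)"
      using * xi by (auto simp: field_simps)
  qed
  thus ?thesis using that[of "1 / x i"] xi by simp
qed

text \<open>Passing from \<open>x\<close> to the standard representative multiplies both values by
  the same non-zero \<open>c ^ v\<close>. Homogeneity is asked of the functions, not of the
  polynomials: the restriction of a form of degree \<open>v\<close> to a line can then be compared
  with a form of degree \<open>k\<close>.\<close>

lemma ev_eq_iff:
  fixes f g :: "'a::field mpol"
  assumes f: "\<And>c x. poly_eval f (\<lambda>i. c * x i) = c ^ v * poly_eval f x"
    and g: "\<And>c x. poly_eval g (\<lambda>i. c * x i) = c ^ v * poly_eval g x"
  shows "ev m f = ev m g \<longleftrightarrow> (\<forall>x\<in>vecs (m + 1) - {\<lambda>_. 0}. poly_eval f x = poly_eval g x)"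
proof -
  have "poly_eval f (std_rep (proj_rel m `` {x})) = poly_eval g (std_rep (proj_rel m `` {x}))
      \<longleftrightarrow> poly_eval f x = poly_eval g x" if x: "x \<in> vecs (m + 1) - {\<lambda>_. 0}" for x
  proof -
    obtain c where c: "c \<noteq> 0" "std_rep (proj_rel m `` {x}) = (\<lambda>i. c * x i)"
      using std_rep_class[OF x] by blast
    show ?thesis unfolding c(2) f g using c(1) by simp
  qed
  thus ?thesis
    unfolding ev_def proj_space_def quotient_def fun_eq_iff restrict_def by auto
qed

lemma ev_cong: "(\<And>x. poly_eval f x = poly_eval g x) \<Longrightarrow> ev m f = ev m g"
  by (simp add: ev_def)

section \<open>Restriction to lines\<close>

lemma keys_sum_subset:
  "(\<And>a. a \<in> A \<Longrightarrow> Poly_Mapping.keys (f a) \<subseteq> B) \<Longrightarrow> Poly_Mapping.keys (sum f A) \<subseteq> B"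
proof
  fix x assume *: "\<And>a. a \<in> A \<Longrightarrow> Poly_Mapping.keys (f a) \<subseteq> B" and "x \<in> Poly_Mapping.keys (sum f A)"
  hence "(\<Sum>a\<in>A. Poly_Mapping.lookup (f a) x) \<noteq> 0"
    by (simp add: in_keys_iff lookup_sum)
  then obtain a where "a \<in> A" "Poly_Mapping.lookup (f a) x \<noteq> 0"
    by (rule sum.not_neutral_contains_not_neutral)
  thus "x \<in> B" using *[of a] by (auto simp: in_keys_iff)
qed

lemma poly_eval_binary_form:
  assumes "h \<in> hom_polys 1 k"
  shows "(\<lambda>s t. poly_eval h (\<lambda>i. if i = 0 then s else if i = 1 then t else 0)) \<in> binary_forms k"
proof -
  have *: "monom_eval d (\<lambda>i. if i = 0 then s else if i = 1 then t else 0) =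
      s ^ Poly_Mapping.lookup d 0 * t ^ Poly_Mapping.lookup d 1"
    "Poly_Mapping.lookup d 0 + Poly_Mapping.lookup d 1 = k"
    if "d \<in> Poly_Mapping.keys h" for d and s t :: 'a
  proof -
    have d: "Poly_Mapping.keys d \<subseteq> {0, 1}" "weight d = k"
      using that assms by (force simp: hom_polys_def simplex_def)+
    show "monom_eval d (\<lambda>i. if i = 0 then s else if i = 1 then t else 0) =
      s ^ Poly_Mapping.lookup d 0 * t ^ Poly_Mapping.lookup d 1"
      using d by (subst monom_eval_superset[of "{0, 1}"]) auto
    show "Poly_Mapping.lookup d 0 + Poly_Mapping.lookup d 1 = k"
      using d weight_superset[of "{0, 1}" d] by simp
  qed
  have "(\<lambda>s t. \<Sum>d\<in>Poly_Mapping.keys h. Poly_Mapping.lookup h d *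
      (s ^ Poly_Mapping.lookup d 0 * t ^ Poly_Mapping.lookup d 1)) \<in> binary_forms k"
    by (intro binary_forms_sum binary_forms_scale binary_forms_monom *)
  thus ?thesis
    by (rule binary_forms_eqI) (simp add: poly_eval_keys[of h] *)
qed

lemma binary_form_obtain_poly:
  assumes "G \<in> binary_forms k"
  obtains h where "h \<in> hom_polys 1 k" "\<And>x. poly_eval h x = G (x 0) (x 1)"
proof -
  from assms obtain c where c: "\<And>s t. G s t = (\<Sum>i\<le>k. c i * s ^ i * t ^ (k - i))"
    unfolding binary_forms_def by blast
  define e :: "nat \<Rightarrow> exps" where
    "e i = Poly_Mapping.single 0 i + Poly_Mapping.single 1 (k - i)" for i
  define h where "h = (\<Sum>i\<le>k. Poly_Mapping.single (e i) (c i))"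
  have e: "e i \<in> simplex (1 + 1) k" if "i \<le> k" for i
  proof -
    have "Poly_Mapping.keys (e i) \<subseteq> {0, 1}"
      using keys_add[of "Poly_Mapping.single 0 i" "Poly_Mapping.single (1::nat) (k - i)"]
      by (auto simp: e_def split: if_splits)
    moreover from this have "weight (e i) = k"
      using that by (subst weight_superset[of "{0, 1}"]) (auto simp: e_def lookup_add lookup_single)
    ultimately show ?thesis by (auto simp: simplex_def)
  qed
  have "h \<in> hom_polys 1 k"
    unfolding hom_polys_def h_def mem_Collect_eq by (rule keys_sum_subset) (use e in auto)
  moreover have "poly_eval h x = G (x 0) (x 1)" for x
  proof -
    have "monom_eval (e i) x = x 0 ^ i * x 1 ^ (k - i)" for i
      by (simp add: e_def monom_eval_add) (simp add: monom_eval_def)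
    thus ?thesis
      by (simp add: h_def poly_eval_sum poly_eval_single c mult_ac)
  qed
  ultimately show ?thesis using that by blast
qed

text \<open>Since \<open>v\<close> and \<open>k\<close> are positive and congruent modulo
  \<open>CARD('a) - 1\<close>, the restriction scales like a form of degree \<open>k\<close>. So
  agreement at projective points extends to all non-zero vectors, and at the origin both sides
  vanish.\<close>

lemma ev_comp_in_PRS_iff:
  fixes f :: "'a::{finite, field} mpol"
  assumes f: "f \<in> hom_polys m v" and "0 < v" "0 < k"
    and vk: "v mod (CARD('a) - 1) = k mod (CARD('a) - 1)"
  shows "ev 1 (poly_comp f L) \<in> PRS k \<longleftrightarrow>
    (\<lambda>s t. poly_eval f (\<lambda>i. L (unit_vec 0) i * s + L (unit_vec 1) i * t)) \<in> binary_forms k"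
    (is "_ \<longleftrightarrow> (\<lambda>s t. ?F s t) \<in> _")
proof -
  have vk': "c ^ v = c ^ k" for c :: 'a
    using assms by (intro power_eq_if_mod_eq) auto
  have hom_f: "poly_eval (poly_comp f L) (\<lambda>i. c * x i) = c ^ k * poly_eval (poly_comp f L) x" for c x
    unfolding poly_eval_comp vk'[symmetric] poly_eval_homogeneous[OF f, symmetric]
    by (simp add: algebra_simps)
  show ?thesis
  proof
    assume "ev 1 (poly_comp f L) \<in> PRS k"
    then obtain h where h: "h \<in> hom_polys 1 k" "ev 1 (poly_comp f L) = ev 1 h"
      by (auto simp: PRS_def)
    have eq: "poly_eval (poly_comp f L) x = poly_eval h x" if "x \<in> vecs (1 + 1)" for x
    proof (cases "x = (\<lambda>_. 0)")
      case True
      thus ?thesis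
        using poly_eval_homogeneous_0[OF h(1) \<open>0 < k\<close>] poly_eval_homogeneous_0[OF f \<open>0 < v\<close>]
        by (simp add: poly_eval_comp)
    next
      case False
      thus ?thesis
        using ev_eq_iff[OF hom_f poly_eval_homogeneous[OF h(1)], of 1] h(2) that by auto
    qed
    show "(\<lambda>s t. ?F s t) \<in> binary_forms k"
    proof (rule binary_forms_eqI[OF poly_eval_binary_form[OF h(1)]])
      fix s t :: 'a
      show "?F s t = poly_eval h (\<lambda>i. if i = 0 then s else if i = 1 then t else 0)"
        by (subst eq[symmetric]) (auto simp: vecs_def poly_eval_comp)
    qed
  next
    assume "(\<lambda>s t. ?F s t) \<in> binary_forms k"
    then obtain h where h: "h \<in> hom_polys 1 k" "\<And>x. poly_eval h x = ?F (x 0) (x 1)"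
      by (rule binary_form_obtain_poly) blast
    have "ev 1 (poly_comp f L) = ev 1 h"
      by (rule ev_cong) (simp add: h poly_eval_comp)
    thus "ev 1 (poly_comp f L) \<in> PRS k"
      using h(1) by (auto simp: PRS_def)
  qed
qed

lemma line_map_in_EmbP:
  fixes a b :: "nat \<Rightarrow> 'a::field"
  assumes "a \<in> vecs (m + 1)" "b \<in> vecs (m + 1)"
    and ind: "\<And>\<alpha> \<beta>. (\<And>i. \<alpha> * a i + \<beta> * b i = 0) \<Longrightarrow> \<alpha> = 0 \<and> \<beta> = 0"
  shows "(\<lambda>x i. a i * x 0 + b i * x 1) \<in> EmbP m"
proof -
  have "inj_on (\<lambda>x i. a i * x 0 + b i * x 1) (vecs 2)"
  proof (rule inj_onI)
    fix x y :: "nat \<Rightarrow> 'a"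
    assume xy: "x \<in> vecs 2" "y \<in> vecs 2"
      and eq: "(\<lambda>i. a i * x 0 + b i * x 1) = (\<lambda>i. a i * y 0 + b i * y 1)"
    have "(x 0 - y 0) * a i + (x 1 - y 1) * b i = 0" for i
      using fun_cong[OF eq, of i] by (simp add: algebra_simps)
    from ind[OF this] have *: "x 0 = y 0" "x 1 = y 1" by auto
    show "x = y"
    proof
      fix i :: nat
      have "i = 0 \<or> i = 1 \<or> i \<ge> 2" by auto
      thus "x i = y i" using xy * by (auto simp: vecs_def)
    qed
  qed
  thus ?thesis using assms(1,2)
    unfolding EmbP_def vecs_def mem_Collect_eq
    by (intro conjI ballI allI funcsetI CollectI impI ext) (simp_all add: distrib_left mult.left_commute)
qed

text \<open>Embeddings correspond to independent pairs \<open>a\<close>, \<open>b\<close>. If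
  instead both are multiples \<open>y * u\<close>, \<open>z * u\<close>, the restriction is
  \<open>f(u)\<close> times the power \<open>v\<close> of \<open>y * s + z * t\<close>, and the
  exponent \<open>v\<close> may be replaced by \<open>k\<close>.\<close>

lemma restrict_lines_iff:
  fixes f :: "'a::{finite, field} mpol"
  assumes f: "f \<in> hom_polys m v" and "0 < v" "0 < k"
    and vk: "v mod (CARD('a) - 1) = k mod (CARD('a) - 1)"
  shows "(\<forall>L\<in>EmbP m. ev 1 (poly_comp f L) \<in> PRS k) \<longleftrightarrow>
    (\<forall>a b. (\<lambda>s t. poly_eval f (\<lambda>i. a i * s + b i * t)) \<in> binary_forms k)"
proof
  assume *: "\<forall>a b. (\<lambda>s t. poly_eval f (\<lambda>i. a i * s + b i * t)) \<in> binary_forms k"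
  show "\<forall>L\<in>EmbP m. ev 1 (poly_comp f L) \<in> PRS k"
  proof
    fix L :: "(nat \<Rightarrow> 'a) \<Rightarrow> nat \<Rightarrow> 'a"
    show "ev 1 (poly_comp f L) \<in> PRS k"
      unfolding ev_comp_in_PRS_iff[OF assms]
      using *[THEN spec, THEN spec, of "L (unit_vec 0)" "L (unit_vec 1)"] .
  qed
next
  assume *: "\<forall>L\<in>EmbP m. ev 1 (poly_comp f L) \<in> PRS k"
  show "\<forall>a b. (\<lambda>s t. poly_eval f (\<lambda>i. a i * s + b i * t)) \<in> binary_forms k"
  proof (intro allI)
    fix a b :: "nat \<Rightarrow> 'a"
    \<comment> \<open>Truncation puts the pair into \<open>vecs (m + 1)\<close>; the indeterminates
      of \<open>f\<close> are numbered up to \<open>m\<close>, so its values do not change.\<close>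
    define a' b' :: "nat \<Rightarrow> 'a" where "a' = (\<lambda>i. if i \<le> m then a i else 0)" and "b' = (\<lambda>i. if i \<le> m then b i else 0)"
    have "(\<lambda>s t. poly_eval f (\<lambda>i. a' i * s + b' i * t)) \<in> binary_forms k"
    proof (cases "\<forall>\<alpha> \<beta>. (\<forall>i. \<alpha> * a' i + \<beta> * b' i = 0) \<longrightarrow> \<alpha> = 0 \<and> \<beta> = 0")
      case True
      have "(\<lambda>x i. a' i * x 0 + b' i * x 1) \<in> EmbP m"
      proof (rule line_map_in_EmbP)
        show "a' \<in> vecs (m + 1)" "b' \<in> vecs (m + 1)"
          by (auto simp: a'_def b'_def vecs_def)
        show "\<alpha> = 0 \<and> \<beta> = 0" if "\<And>i. \<alpha> * a' i + \<beta> * b' i = 0" for \<alpha> \<beta>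
          using True[THEN spec, THEN spec, of \<alpha> \<beta>] that by simp
      qed
      hence "ev 1 (poly_comp f (\<lambda>x i. a' i * x 0 + b' i * x 1)) \<in> PRS k"
        using * by (rule bspec[rotated])
      thus ?thesis
        by (simp add: ev_comp_in_PRS_iff[OF assms] unit_vec_def)
    next
      case False
      then obtain \<alpha> \<beta> where \<alpha>\<beta>: "\<alpha> \<noteq> 0 \<or> \<beta> \<noteq> 0" "\<And>i. \<alpha> * a' i + \<beta> * b' i = 0"
        by blast
      have "\<exists>u y z. \<forall>i. a' i = y * u i \<and> b' i = z * u i"
      proof (cases "\<alpha> = 0")
        case True
        have "a' i = 1 * a' i \<and> b' i = 0 * a' i" for i
          using \<alpha>\<beta> True by simp
        thus ?thesis by blast
      next
        case False
        have "a' i = - \<beta> / \<alpha> * b' i \<and> b' i = 1 * b' i" for i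
          using \<alpha>\<beta>(2)[of i] False by (simp add: field_simps eq_neg_iff_add_eq_0)
        thus ?thesis by blast
      qed
      then obtain u y z where u: "\<And>i. a' i = y * u i" "\<And>i. b' i = z * u i" by blast
      have "(\<lambda>s t. poly_eval f u * (y * s + z * t) ^ k) \<in> binary_forms k"
        using binary_forms_scale[OF binary_forms_power[OF binary_forms_linear[of y z], of k],
            of "poly_eval f u"] by simp
      thus ?thesis
      proof (rule binary_forms_eqI)
        fix s t
        have "(y * s + z * t) ^ v = (y * s + z * t) ^ k"
          using assms by (intro power_eq_if_mod_eq) auto
        thus "poly_eval f (\<lambda>i. a' i * s + b' i * t) = poly_eval f u * (y * s + z * t) ^ k"
          using poly_eval_homogeneous[OF f, of "y * s + z * t" u] by (simp add: u algebra_simps)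
      qed
    qed
    thus "(\<lambda>s t. poly_eval f (\<lambda>i. a i * s + b i * t)) \<in> binary_forms k"
      by (rule binary_forms_eqI) (rule poly_eval_cong[OF f], simp add: a'_def b'_def)
  qed
qed

section \<open>P-reduction\<close>

lemma P_step_lookup:
  assumes "P_step q d d'" "q > 0"
  obtains i j where "i < j" "Poly_Mapping.lookup d i \<ge> 1" "Poly_Mapping.lookup d j \<ge> q"
    "\<And>l. Poly_Mapping.lookup d' l = Poly_Mapping.lookup d l
      + (if l = i then q - 1 else 0) - (if l = j then q - 1 else 0)"
proof -
  from assms(1) obtain i j where ij: "i < j" "Poly_Mapping.lookup d i \<ge> 1" "Poly_Mapping.lookup d j \<ge> q"
    and eq: "d' + Poly_Mapping.single j (q - 1) = d + Poly_Mapping.single i (q - 1)"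
    unfolding P_step_def by blast
  have "Poly_Mapping.lookup d' l + (if l = j then q - 1 else 0)
      = Poly_Mapping.lookup d l + (if l = i then q - 1 else 0)" for l
    using arg_cong[OF eq, of "\<lambda>x. Poly_Mapping.lookup x l"]
    by (auto simp: lookup_add lookup_single when_def split: if_splits)
  hence "Poly_Mapping.lookup d' l = Poly_Mapping.lookup d l
      + (if l = i then q - 1 else 0) - (if l = j then q - 1 else 0)" for l
    by (metis add_diff_cancel_right')
  thus ?thesis using that ij by blast
qed

text \<open>The entry that loses \<open>q - 1\<close> was at least \<open>q\<close> and stays
  positive; the entry that gains was already positive.\<close>

lemma P_step_keys:
  assumes "P_step q d d'" "q > 0"
  shows "Poly_Mapping.keys d' = Poly_Mapping.keys d"
proof -
  obtain i j where ij: "i < j" "Poly_Mapping.lookup d i \<ge> 1" "Poly_Mapping.lookup d j \<ge> q"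
    "\<And>l. Poly_Mapping.lookup d' l = Poly_Mapping.lookup d l
      + (if l = i then q - 1 else 0) - (if l = j then q - 1 else 0)"
    using P_step_lookup[OF assms] by blast
  have "Poly_Mapping.lookup d' l = 0 \<longleftrightarrow> Poly_Mapping.lookup d l = 0" for l
    using ij(1-3) assms(2) by (auto simp: ij(4))
  thus ?thesis by (auto simp: in_keys_iff)
qed

text \<open>A move preserves residues modulo \<open>q - 1\<close> and the positions of the zeros,
  and these two determine the reductions.\<close>

lemma P_step_red:
  assumes "P_step q d d'" "2 \<le> q"
  shows "red q (Poly_Mapping.lookup d' l) = red q (Poly_Mapping.lookup d l)"
proof -
  have q: "q > 0" using assms(2) by simp
  obtain i j where ij: "i < j" "Poly_Mapping.lookup d i \<ge> 1" "Poly_Mapping.lookup d j \<ge> q"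
    "\<And>l. Poly_Mapping.lookup d' l = Poly_Mapping.lookup d l
      + (if l = i then q - 1 else 0) - (if l = j then q - 1 else 0)"
    using P_step_lookup[OF assms(1) q] by blast
  have "Poly_Mapping.lookup d' l = 0 \<longleftrightarrow> Poly_Mapping.lookup d l = 0"
    using P_step_keys[OF assms(1) q] by (metis in_keys_iff)
  moreover have "Poly_Mapping.lookup d' l mod (q - 1) = Poly_Mapping.lookup d l mod (q - 1)"
  proof (cases "l = j")
    case True
    hence "Poly_Mapping.lookup d' l = Poly_Mapping.lookup d l - (q - 1)" "q - 1 \<le> Poly_Mapping.lookup d l"
      using ij by auto
    thus ?thesis by (simp add: le_mod_geq)
  qed (simp add: ij(4))
  ultimately show ?thesis by (simp add: red_eq_iff[OF assms(2)])
qed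

text \<open>Coordinate weights \<open>w\<close> are arbitrary so that the identity serves twice:
  constant \<open>w\<close> shows that the weight is invariant, and \<open>w l = l\<close> gives the
  termination measure.\<close>

lemma P_step_sum:
  fixes w :: "nat \<Rightarrow> nat"
  assumes "P_step q d d'" "q > 0"
  obtains i j where "i < j" "Poly_Mapping.lookup d j \<ge> q"
    "(\<Sum>l\<in>Poly_Mapping.keys d'. w l * Poly_Mapping.lookup d' l) + w j * (q - 1)
      = (\<Sum>l\<in>Poly_Mapping.keys d. w l * Poly_Mapping.lookup d l) + w i * (q - 1)"
proof -
  obtain i j where ij: "i < j" "Poly_Mapping.lookup d i \<ge> 1" "Poly_Mapping.lookup d j \<ge> q"
    "\<And>l. Poly_Mapping.lookup d' l = Poly_Mapping.lookup d l
      + (if l = i then q - 1 else 0) - (if l = j then q - 1 else 0)"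
    using P_step_lookup[OF assms] by blast
  have keys: "i \<in> Poly_Mapping.keys d" "j \<in> Poly_Mapping.keys d"
    using ij assms(2) by (auto simp: in_keys_iff)
  have "w l * Poly_Mapping.lookup d' l + (if l = j then w j * (q - 1) else 0)
      = w l * Poly_Mapping.lookup d l + (if l = i then w i * (q - 1) else 0)" for l
  proof -
    have "Poly_Mapping.lookup d' l + (if l = j then q - 1 else 0)
        = Poly_Mapping.lookup d l + (if l = i then q - 1 else 0)"
      using ij(1,3) by (auto simp: ij(4))
    hence "w l * (Poly_Mapping.lookup d' l + (if l = j then q - 1 else 0))
        = w l * (Poly_Mapping.lookup d l + (if l = i then q - 1 else 0))" by simp
    thus ?thesis unfolding distrib_left by (auto split: if_splits)
  qed
  hence "(\<Sum>l\<in>Poly_Mapping.keys d. w l * Poly_Mapping.lookup d' l + (if l = j then w j * (q - 1) else 0))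
      = (\<Sum>l\<in>Poly_Mapping.keys d. w l * Poly_Mapping.lookup d l + (if l = i then w i * (q - 1) else 0))"
    by (intro sum.cong) auto
  thus ?thesis
    using that[of i j] ij keys P_step_keys[OF assms] by (simp add: sum.distrib)
qed

lemma P_step_weight:
  assumes "P_step q d d'" "q > 0"
  shows "weight d' = weight d"
  by (rule P_step_sum[OF assms, of "\<lambda>_. 1"]) (simp add: weight_def)

text \<open>A step moves mass to the left, so \<open>\<Sum>i. i * d\<^sub>i\<close> decreases.\<close>

lemma P_step_normalizes:
  assumes "2 \<le> q"
  shows "\<exists>d'. (P_step q)\<^sup>*\<^sup>* d d' \<and> (\<nexists>d''. P_step q d' d'')"
proof (induction "\<Sum>l\<in>Poly_Mapping.keys d. l * Poly_Mapping.lookup d l" arbitrary: d rule: less_induct)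
  case less
  show ?case
  proof (cases "\<exists>d'. P_step q d d'")
    case True
    then obtain d' where d': "P_step q d d'" by blast
    then obtain i j where ij: "i < j"
      "(\<Sum>l\<in>Poly_Mapping.keys d'. l * Poly_Mapping.lookup d' l) + j * (q - 1)
      = (\<Sum>l\<in>Poly_Mapping.keys d. l * Poly_Mapping.lookup d l) + i * (q - 1)"
      by (rule P_step_sum[of q d d' "\<lambda>l. l"]) (use assms in auto)
    moreover have "i * (q - 1) < j * (q - 1)"
      using ij assms by simp
    ultimately have "(\<Sum>l\<in>Poly_Mapping.keys d'. l * Poly_Mapping.lookup d' l)
        < (\<Sum>l\<in>Poly_Mapping.keys d. l * Poly_Mapping.lookup d l)" by linarith
    from less[OF this] d' show ?thesis
      by (meson converse_rtranclp_into_rtranclp)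
  qed blast
qed

lemma P_step_ex:
  assumes "i < j" "Poly_Mapping.lookup d i \<ge> 1" "Poly_Mapping.lookup d j \<ge> q"
  shows "\<exists>d'. P_step q d d'"
proof -
  have "d - Poly_Mapping.single j (q - 1) + Poly_Mapping.single i (q - 1) + Poly_Mapping.single j (q - 1)
      = d + Poly_Mapping.single i (q - 1)"
    by (rule poly_mapping_eqI) (use assms in \<open>auto simp: lookup_add lookup_minus lookup_single when_def\<close>)
  thus ?thesis using assms unfolding P_step_def by blast
qed

text \<open>An entry at least \<open>q\<close> admits a move exactly when a non-zero entry lies to
  its left; two entries at least \<open>q\<close> are the special case behind the second clause of
  \<open>P_reduced\<close>.\<close>

lemma P_step_normal_iff:
  assumes "2 \<le> q"
  shows "(\<nexists>d'. P_step q d d') \<longleftrightarrow> P_reduced q d"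
proof
  assume *: "\<nexists>d'. P_step q d d'"
  show "P_reduced q d"
    unfolding P_reduced_def
  proof (intro allI impI conjI)
    fix i j assume i: "q \<le> Poly_Mapping.lookup d i"
    show "Poly_Mapping.lookup d j = 0" if "j < i"
      using P_step_ex[of j i d q] that i * by (metis less_one not_le)
    show "Poly_Mapping.lookup d j \<le> q - 1" if "i < j"
    proof (rule ccontr)
      assume "\<not> Poly_Mapping.lookup d j \<le> q - 1"
      hence "q \<le> Poly_Mapping.lookup d j" "1 \<le> Poly_Mapping.lookup d i"
        using i assms by linarith+
      thus False using P_step_ex[of i j d q] that * by blast
    qed
  qed
next
  assume red: "P_reduced q d"
  show "\<nexists>d'. P_step q d d'"
  proof
    assume "\<exists>d'. P_step q d d'"
    then obtain d' where "P_step q d d'" by blast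
    then obtain i j where "i < j" "Poly_Mapping.lookup d i \<ge> 1" "Poly_Mapping.lookup d j \<ge> q"
      by (rule P_step_lookup) (use assms in auto)
    thus False using red unfolding P_reduced_def by force
  qed
qed

section \<open>Leftmost non-zero entries and uniqueness of normal forms\<close>

lemma iota_lookup: "d \<noteq> 0 \<Longrightarrow> Poly_Mapping.lookup d (iota d) \<noteq> 0"
  unfolding iota_def by (rule LeastI_ex) (metis lookup_zero poly_mapping_eqI)

lemma less_iota_lookup: "i < iota d \<Longrightarrow> Poly_Mapping.lookup d i = 0"
  unfolding iota_def using not_less_Least by blast

lemma simplex_neq_0: "d \<in> simplex n v \<Longrightarrow> 0 < v \<Longrightarrow> d \<noteq> 0"
  by (auto simp: simplex_def weight_def)

lemma iota_less:
  assumes "d \<in> simplex n v" "0 < v"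
  shows "iota d < n"
proof -
  have "iota d \<in> Poly_Mapping.keys d"
    using iota_lookup[OF simplex_neq_0[OF assms]] by (simp add: in_keys_iff)
  thus ?thesis using assms(1) by (auto simp: simplex_def)
qed

text \<open>In a reduced tuple an entry at least \<open>q\<close> has only zeros to its left, so it
  sits at \<open>iota d\<close>.\<close>

lemma P_reduced_lookup_less:
  assumes "P_reduced q d" "q > 0" "i \<noteq> iota d"
  shows "Poly_Mapping.lookup d i < q"
proof (cases "d = 0")
  case False
  show ?thesis
  proof (rule ccontr)
    assume *: "\<not> ?thesis"
    hence "\<forall>j<i. Poly_Mapping.lookup d j = 0"
      using assms(1) unfolding P_reduced_def not_less by blast
    moreover have "\<not> i < iota d"
      using * less_iota_lookup[of i d] assms(2) by auto
    ultimately show False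
      using iota_lookup[OF False] assms(3) by auto
  qed
qed (use assms in simp)

text \<open>Equal reductions give equal zeros, hence the same \<open>iota\<close>. All other entries
  are below \<open>q\<close> and thus their own reductions; the entry at \<open>iota d\<close> is
  then fixed by the weight.\<close>

lemma P_reduced_eqI:
  assumes "P_reduced q d" "P_reduced q d'" "2 \<le> q" "weight d = weight d'"
    and red: "\<And>i. red q (Poly_Mapping.lookup d i) = red q (Poly_Mapping.lookup d' i)"
  shows "d = d'"
proof -
  have zero: "Poly_Mapping.lookup d i = 0 \<longleftrightarrow> Poly_Mapping.lookup d' i = 0" for i
    using red[of i] red_eq_0_iff[OF assms(3)] by metis
  hence iota: "iota d = iota d'" by (simp add: iota_def)
  have eq: "Poly_Mapping.lookup d i = Poly_Mapping.lookup d' i" if "i \<noteq> iota d" for i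
  proof -
    have "Poly_Mapping.lookup d i < q" "Poly_Mapping.lookup d' i < q"
      using that assms(1-3) iota by (auto intro!: P_reduced_lookup_less)
    thus ?thesis using red[of i] by (simp add: red_eq_self)
  qed
  have keys: "Poly_Mapping.keys d = Poly_Mapping.keys d'"
    using zero by (auto simp: in_keys_iff)
  have "Poly_Mapping.lookup d (iota d) = Poly_Mapping.lookup d' (iota d)"
  proof (cases "iota d \<in> Poly_Mapping.keys d")
    case True
    have "(\<Sum>i\<in>Poly_Mapping.keys d - {iota d}. Poly_Mapping.lookup d i)
        = (\<Sum>i\<in>Poly_Mapping.keys d - {iota d}. Poly_Mapping.lookup d' i)"
      by (intro sum.cong) (auto simp: eq)
    thus ?thesis
      using assms(4) sum.remove[OF finite_keys True, of "Poly_Mapping.lookup d"]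
        sum.remove[OF finite_keys True, of "Poly_Mapping.lookup d'"]
      by (simp add: weight_def keys)
  next
    case False
    thus ?thesis using zero[of "iota d"] by (simp add: in_keys_iff)
  qed
  thus ?thesis using eq by (metis poly_mapping_eqI)
qed

lemma P_steps_invariant:
  assumes "(P_step q)\<^sup>*\<^sup>* d d'" "2 \<le> q"
  shows "weight d' = weight d \<and> Poly_Mapping.keys d' = Poly_Mapping.keys d \<and>
    (\<forall>i. red q (Poly_Mapping.lookup d' i) = red q (Poly_Mapping.lookup d i))"
  using assms(1)
proof (induction rule: rtranclp_induct)
  case (step d' d'')
  thus ?case
    using P_step_weight[OF step(2)] P_step_keys[OF step(2)] P_step_red[OF step(2) assms(2)] assms(2)
    by auto
qed auto

text \<open>Uniqueness of the normal form comes from invariants instead of confluence: moves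
  preserve the weight and the reduced entries, which determine a reduced tuple.\<close>

lemma P_reduction:
  assumes "2 \<le> q"
  shows "P_reduced q (P_reduction q d)" "weight (P_reduction q d) = weight d"
    "Poly_Mapping.keys (P_reduction q d) = Poly_Mapping.keys d"
    "red q (Poly_Mapping.lookup (P_reduction q d) i) = red q (Poly_Mapping.lookup d i)"
proof -
  obtain d' where d': "(P_step q)\<^sup>*\<^sup>* d d'" "\<nexists>d''. P_step q d' d''"
    using P_step_normalizes[OF assms] by blast
  have "P_reduction q d = d'"
    unfolding P_reduction_def
  proof (rule the_equality)
    fix e assume e: "(P_step q)\<^sup>*\<^sup>* d e \<and> (\<nexists>d''. P_step q e d'')"
    show "e = d'"
      using P_steps_invariant[OF d'(1) assms] P_steps_invariant[of q d e] e d'(2) assms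
      by (intro P_reduced_eqI[of q]) (auto simp flip: P_step_normal_iff[OF assms])
  qed (use d' in blast)
  thus "P_reduced q (P_reduction q d)" "weight (P_reduction q d) = weight d"
    "Poly_Mapping.keys (P_reduction q d) = Poly_Mapping.keys d"
    "red q (Poly_Mapping.lookup (P_reduction q d) i) = red q (Poly_Mapping.lookup d i)"
    using d'(2) P_steps_invariant[OF d'(1) assms] by (auto simp flip: P_step_normal_iff[OF assms])
qed

lemma P_reduction_eq_self:
  assumes "2 \<le> q" "P_reduced q d"
  shows "P_reduction q d = d"
  using P_reduction[OF assms(1), of d] assms by (intro P_reduced_eqI[of q]) auto

lemma P_reduction_in_simplex:
  "2 \<le> q \<Longrightarrow> d \<in> simplex n v \<Longrightarrow> P_reduction q d \<in> simplex n v"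
  using P_reduction[of q d] by (simp add: simplex_def)

lemma monom_eval_P_reduction:
  fixes x :: "nat \<Rightarrow> 'a::{finite, field}"
  shows "monom_eval (P_reduction CARD('a) d) x = monom_eval d x"
proof -
  note * = P_reduction[OF card_field_ge2[where 'a = 'a], of d]
  show ?thesis unfolding monom_eval_def *(3)
  proof (rule prod.cong)
    fix i
    show "x i ^ Poly_Mapping.lookup (P_reduction CARD('a) d) i = x i ^ Poly_Mapping.lookup d i"
      using *(4)[of i] power_red[of "x i"] by metis
  qed auto
qed

section \<open>Averaging against dual weights\<close>

lemma sum_PiE_prod:
  fixes g :: "nat \<Rightarrow> 'b::finite \<Rightarrow> 'a::comm_semiring_1"
  shows "(\<Sum>x\<in>Pi\<^sub>E {..m} (\<lambda>_. UNIV). \<Prod>i\<le>m. g i (x i)) = (\<Prod>i\<le>m. \<Sum>y\<in>UNIV. g i y)"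
  by (rule prod_sum_PiE[symmetric]) auto

lemma hom_poly_eval_atMost:
  assumes "f \<in> hom_polys m v"
  shows "poly_eval f x = (\<Sum>d\<in>Poly_Mapping.keys f. Poly_Mapping.lookup f d * (\<Prod>i\<le>m. x i ^ Poly_Mapping.lookup d i))"
  unfolding poly_eval_keys[of f]
proof (intro sum.cong refl arg_cong2[where f = "(*)"] monom_eval_superset)
  fix d assume "d \<in> Poly_Mapping.keys f"
  thus "Poly_Mapping.keys d \<subseteq> {..m}"
    using assms by (fastforce simp: hom_polys_def simplex_def)
qed auto

text \<open>Linear independence of reduced monomials of one degree as functions: averaging against
  the product of the dual weights for an exponent \<open>d\<close> of \<open>f\<close> picks out the
  exponents with the same reduced entries, hence only \<open>d\<close>.\<close>

lemma P_reduced_poly_eq_0: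
  fixes f :: "'a::{finite, field} mpol"
  assumes f: "f \<in> hom_polys m v" "0 < v" "\<And>d. d \<in> Poly_Mapping.keys f \<Longrightarrow> P_reduced CARD('a) d"
    and zero: "\<And>x. x \<in> vecs (m + 1) - {\<lambda>_. 0} \<Longrightarrow> poly_eval f x = 0"
  shows "f = 0"
proof (rule ccontr)
  assume "f \<noteq> 0"
  then obtain d where d: "d \<in> Poly_Mapping.keys f"
    by (metis poly_mapping_eqI lookup_zero in_keys_iff)
  define q where "q = CARD('a)"
  note q2 = card_field_ge2[where 'a = 'a, folded q_def]
  define w :: "nat \<Rightarrow> 'a \<Rightarrow> 'a" where "w i = dual_weight (red q (Poly_Mapping.lookup d i))" for i
  have all_zero: "poly_eval f x = 0" for x
  proof -
    define y where "y = (\<lambda>i. if i \<le> m then x i else 0)"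
    have "poly_eval f x = poly_eval f y"
      by (rule poly_eval_cong[OF f(1)]) (simp add: y_def)
    also have "\<dots> = 0"
      using zero[of y] poly_eval_homogeneous_0[OF f(1,2)]
      by (cases "y = (\<lambda>_. 0)") (auto simp: y_def vecs_def)
    finally show ?thesis .
  qed
  have dual: "(\<Prod>i\<le>m. \<Sum>y\<in>UNIV. w i y * y ^ Poly_Mapping.lookup d' i) = (if d' = d then 1 else 0)"
    if d': "d' \<in> Poly_Mapping.keys f" for d'
  proof -
    have *: "(\<Sum>y\<in>UNIV. w i y * y ^ Poly_Mapping.lookup d' i) =
        (if red q (Poly_Mapping.lookup d' i) = red q (Poly_Mapping.lookup d i) then 1 else 0)" for i
      unfolding w_def q_def
      by (rule sum_dual_weight_power) (use red_less[OF q2] in \<open>simp add: q_def\<close>)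
    have "d' = d" if "\<forall>i\<le>m. red q (Poly_Mapping.lookup d' i) = red q (Poly_Mapping.lookup d i)"
    proof (rule P_reduced_eqI[OF _ _ q2])
      show "P_reduced q d'" "P_reduced q d" using f(3) d d' by (auto simp: q_def)
      show "weight d' = weight d" using f(1) d d' by (auto simp: hom_polys_def simplex_def)
      show "red q (Poly_Mapping.lookup d' i) = red q (Poly_Mapping.lookup d i)" for i
      proof (cases "i \<le> m")
        case False
        hence "i \<notin> Poly_Mapping.keys d" "i \<notin> Poly_Mapping.keys d'"
          using f(1) d d' by (fastforce simp: hom_polys_def simplex_def)+
        thus ?thesis by (simp add: in_keys_iff)
      qed (use that in auto)
    qed
    thus ?thesis unfolding * by (auto simp: prod_zero_iff)
  qed
  \<comment> \<open>The sum over all points of affine space factors into sums over single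
    coordinates.\<close>
  have "0 = (\<Sum>x\<in>Pi\<^sub>E {..m} (\<lambda>_. UNIV). (\<Prod>i\<le>m. w i (x i)) * poly_eval f x)"
    by (simp add: all_zero)
  also have "\<dots> = (\<Sum>x\<in>Pi\<^sub>E {..m} (\<lambda>_. UNIV). \<Sum>d'\<in>Poly_Mapping.keys f.
      Poly_Mapping.lookup f d' * (\<Prod>i\<le>m. w i (x i) * x i ^ Poly_Mapping.lookup d' i))"
    unfolding hom_poly_eval_atMost[OF f(1)] sum_distrib_left prod.distrib
    by (intro sum.cong refl) (rule mult.left_commute)
  also have "\<dots> = (\<Sum>d'\<in>Poly_Mapping.keys f. Poly_Mapping.lookup f d' *
      (\<Prod>i\<le>m. \<Sum>y\<in>UNIV. w i y * y ^ Poly_Mapping.lookup d' i))"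
    by (subst sum.swap, subst sum_PiE_prod[symmetric], subst sum_distrib_left) (rule refl)
  also have "\<dots> = (\<Sum>d'\<in>Poly_Mapping.keys f. Poly_Mapping.lookup f d' * (if d' = d then 1 else 0))"
    using dual by (intro sum.cong) auto
  also have "\<dots> = Poly_Mapping.lookup f d"
    using d by (simp add: if_distrib[of "\<lambda>x. _ * x"] cong: if_cong)
  finally show False using d by (simp add: in_keys_iff)
qed

section \<open>Necessity of the digit condition\<close>

lemma red_add_cong:
  assumes "2 \<le> q" "red q a = red q a'" "red q b = red q b'"
  shows "red q (a + b) = red q (a' + b')"
  using assms(2,3) unfolding red_eq_iff[OF assms(1)] by (auto intro: mod_add_cong)

text \<open>The contribution of one coordinate: \<open>z\<close> is the pair of its values at the
  two spanning vectors. After binomial expansion the two weights act on the two components of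
  \<open>z\<close> separately.\<close>

lemma sum_dual_weight_binomial:
  fixes s t :: "'a::{finite, field}"
  assumes "A < CARD('a)" "B < CARD('a)"
  shows "(\<Sum>z\<in>UNIV. dual_weight A (fst z) * dual_weight B (snd z) * (fst z * s + snd z * t) ^ n) =
    (\<Sum>j\<le>n. if red CARD('a) j = A \<and> red CARD('a) (n - j) = B
      then of_nat (n choose j) * s ^ j * t ^ (n - j) else 0)"
proof -
  have "(\<Sum>z\<in>UNIV. dual_weight A (fst z) * dual_weight B (snd z) * (fst z * s + snd z * t) ^ n) =
      (\<Sum>z\<in>UNIV. \<Sum>j\<le>n. of_nat (n choose j) * s ^ j * t ^ (n - j) *
        ((dual_weight A (fst z) * fst z ^ j) * (dual_weight B (snd z) * snd z ^ (n - j))))"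
    by (simp add: binomial_ring sum_distrib_left power_mult_distrib mult_ac)
  also have "\<dots> = (\<Sum>j\<le>n. of_nat (n choose j) * s ^ j * t ^ (n - j) *
      (\<Sum>z\<in>UNIV. (dual_weight A (fst z) * fst z ^ j) * (dual_weight B (snd z) * snd z ^ (n - j))))"
    by (subst sum.swap) (simp add: sum_distrib_left)
  also have "\<dots> = (\<Sum>j\<le>n. of_nat (n choose j) * s ^ j * t ^ (n - j) *
      ((\<Sum>x\<in>UNIV. dual_weight A x * x ^ j) * (\<Sum>y\<in>UNIV. dual_weight B y * y ^ (n - j))))"
    unfolding sum_product sum.cartesian_product UNIV_Times_UNIV by (simp add: case_prod_unfold)
  also have "\<dots> = (\<Sum>j\<le>n. if red CARD('a) j = A \<and> red CARD('a) (n - j) = B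
      then of_nat (n choose j) * s ^ j * t ^ (n - j) else 0)"
    using assms by (intro sum.cong) (auto simp: sum_dual_weight_power)
  finally show ?thesis .
qed

text \<open>
  Averaging \<open>f(a S + b T)\<close> over all \<open>a, b\<close> against dual weights isolates one term of the
  expansion of a single monomial of \<open>f\<close>: as \<open>e\<close> vanishes at \<open>iota d\<close>, the pair \<open>(d - e, e)\<close> can be
  recovered from its reductions.
\<close>

lemma P_reduced_lines_imp_red_le:
  fixes f :: "'a::{finite, field} mpol"
  assumes f: "f \<in> hom_polys m v" "0 < v" "\<And>d. d \<in> Poly_Mapping.keys f \<Longrightarrow> P_reduced CARD('a) d"
    and lines: "\<And>a b. (\<lambda>s t. poly_eval f (\<lambda>i. a i * s + b i * t)) \<in> binary_forms k"
    and k: "k < CARD('a)"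
    and p: "prime p" "CHAR('a) = p"
    and d: "d \<in> Poly_Mapping.keys f"
    and e: "\<And>i. digit_le p (e i) (Poly_Mapping.lookup d i)" "e (iota d) = 0"
  shows "red CARD('a) (\<Sum>i\<le>m. e i) \<le> k - 1"
proof -
  define q where "q = CARD('a)"
  note q2 = card_field_ge2[where 'a = 'a, folded q_def]
  have red_q: "red q n < CARD('a)" for n
    using red_less[OF q2] by (simp add: q_def)
  have e_le: "e i \<le> Poly_Mapping.lookup d i" for i
    using digit_le_imp_le[OF prime_ge_2_nat[OF p(1)] e(1)] .
  \<comment> \<open>The weights are chosen to select the powers of the coordinates of
    \<open>a\<close> and \<open>b\<close> whose exponents reduce like \<open>d - e\<close> and
    \<open>e\<close>.\<close>
  define A B where "A i = red q (Poly_Mapping.lookup d i - e i)" and "B i = red q (e i)" for i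
  define W :: "(nat \<Rightarrow> 'a \<times> 'a) \<Rightarrow> 'a" where
    "W c = (\<Prod>i\<le>m. dual_weight (A i) (fst (c i)) * dual_weight (B i) (snd (c i)))" for c
  define \<phi> :: "nat \<Rightarrow> nat \<Rightarrow> 'a \<Rightarrow> 'a \<Rightarrow> 'a" where
    "\<phi> i n s t = (\<Sum>j\<le>n. if red q j = A i \<and> red q (n - j) = B i
      then of_nat (n choose j) * s ^ j * t ^ (n - j) else 0)" for i n s t
  have \<phi>: "(\<Sum>z\<in>UNIV. dual_weight (A i) (fst z) * dual_weight (B i) (snd z) * (fst z * s + snd z * t) ^ n)
      = \<phi> i n s t" for i n s t
    unfolding \<phi>_def q_def by (rule sum_dual_weight_binomial) (use red_q in \<open>simp_all add: A_def B_def\<close>)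
  define F where "F s t = (\<Sum>c\<in>Pi\<^sub>E {..m} (\<lambda>_. UNIV).
      W c * poly_eval f (\<lambda>i. fst (c i) * s + snd (c i) * t))" for s t
  have F_form: "F \<in> binary_forms k"
    unfolding F_def by (intro binary_forms_sum binary_forms_scale lines)
  have F_eq: "F s t = (\<Sum>d'\<in>Poly_Mapping.keys f. Poly_Mapping.lookup f d' *
      (\<Prod>i\<le>m. \<phi> i (Poly_Mapping.lookup d' i) s t))" for s t
  proof -
    have "F s t = (\<Sum>c\<in>Pi\<^sub>E {..m} (\<lambda>_. UNIV). \<Sum>d'\<in>Poly_Mapping.keys f. Poly_Mapping.lookup f d' *
        (\<Prod>i\<le>m. dual_weight (A i) (fst (c i)) * dual_weight (B i) (snd (c i)) *
          (fst (c i) * s + snd (c i) * t) ^ Poly_Mapping.lookup d' i))"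
      unfolding F_def W_def hom_poly_eval_atMost[OF f(1)] sum_distrib_left prod.distrib
      by (intro sum.cong refl) (rule mult.left_commute)
    also have "\<dots> = (\<Sum>d'\<in>Poly_Mapping.keys f. Poly_Mapping.lookup f d' * (\<Prod>i\<le>m. \<Sum>z\<in>UNIV.
        dual_weight (A i) (fst z) * dual_weight (B i) (snd z) *
          (fst z * s + snd z * t) ^ Poly_Mapping.lookup d' i))"
      by (subst sum.swap, subst sum_PiE_prod[symmetric], subst sum_distrib_left) (rule refl)
    finally show ?thesis unfolding \<phi> .
  qed
  \<comment> \<open>A surviving term splits each entry of \<open>d'\<close> into two parts with the
    same reductions as those of \<open>d - e\<close> and \<open>e\<close>. Adding the parts,
    \<open>d'\<close> and \<open>d\<close> have the same reduced entries and so coincide.\<close>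
  have other: "(\<Prod>i\<le>m. \<phi> i (Poly_Mapping.lookup d' i) s t) = 0"
    if d': "d' \<in> Poly_Mapping.keys f" "d' \<noteq> d" for d' s t
  proof (rule ccontr)
    assume "(\<Prod>i\<le>m. \<phi> i (Poly_Mapping.lookup d' i) s t) \<noteq> 0"
    hence nz: "\<phi> i (Poly_Mapping.lookup d' i) s t \<noteq> 0" if "i \<le> m" for i
      using that by simp
    have "d' = d"
    proof (rule P_reduced_eqI[OF _ _ q2])
      show "P_reduced q d'" "P_reduced q d" using f(3) d d' by (auto simp: q_def)
      show "weight d' = weight d" using f(1) d d' by (auto simp: hom_polys_def simplex_def)
      show "red q (Poly_Mapping.lookup d' i) = red q (Poly_Mapping.lookup d i)" for i
      proof (cases "i \<le> m")
        case True
        from nz[OF this] obtain j where "j \<le> Poly_Mapping.lookup d' i" "red q j = A i"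
          "red q (Poly_Mapping.lookup d' i - j) = B i"
          unfolding \<phi>_def by (auto elim!: sum.not_neutral_contains_not_neutral split: if_splits)
        thus ?thesis
          using red_add_cong[OF q2, of j "Poly_Mapping.lookup d i - e i"
              "Poly_Mapping.lookup d' i - j" "e i"] e_le[of i]
          by (simp add: A_def B_def)
      next
        case False
        hence "i \<notin> Poly_Mapping.keys d" "i \<notin> Poly_Mapping.keys d'"
          using f(1) d d' by (fastforce simp: hom_polys_def simplex_def)+
        thus ?thesis by (simp add: in_keys_iff)
      qed
    qed
    thus False using d' by simp
  qed
  have self: "\<phi> i (Poly_Mapping.lookup d i) s t =
      of_nat (Poly_Mapping.lookup d i choose e i) * s ^ (Poly_Mapping.lookup d i - e i) * t ^ e i" for i s t
  proof -
    let ?n = "Poly_Mapping.lookup d i"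
    \<comment> \<open>At \<open>iota d\<close> the entry may be \<open>q\<close> or larger, but
      \<open>B i = 0\<close> there, and only \<open>0\<close> reduces to \<open>0\<close>. Elsewhere
      all numbers are below \<open>q\<close> and reduction does nothing.\<close>
    have "j = ?n - e i" if j: "j \<le> ?n" "red q j = A i" "red q (?n - j) = B i" for j
    proof (cases "i = iota d")
      case True
      hence "?n - j = 0"
        using j(3) e(2) red_eq_0_iff[OF q2, of 0] red_eq_0_iff[OF q2, of "?n - j"] by (simp add: B_def)
      thus ?thesis using j True e(2) by simp
    next
      case False
      hence "?n < q"
        using P_reduced_lookup_less[OF f(3)[OF d]] q2 by (simp add: q_def)
      thus ?thesis using j by (simp add: A_def red_eq_self)
    qed
    hence "\<phi> i ?n s t = (\<Sum>j\<in>{?n - e i}. if red q j = A i \<and> red q (?n - j) = B i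
      then of_nat (?n choose j) * s ^ j * t ^ (?n - j) else 0)"
      unfolding \<phi>_def by (intro sum.mono_neutral_right) auto
    thus ?thesis
      using e_le[of i] by (simp add: A_def B_def binomial_symmetric[of "e i" ?n])
  qed
  define C where "C = Poly_Mapping.lookup f d * (\<Prod>i\<le>m. of_nat (Poly_Mapping.lookup d i choose e i))"
  have "F s t = C * (s ^ (\<Sum>i\<le>m. Poly_Mapping.lookup d i - e i) * t ^ (\<Sum>i\<le>m. e i))" for s t
  proof -
    have "F s t = (\<Sum>d'\<in>{d}. Poly_Mapping.lookup f d' * (\<Prod>i\<le>m. \<phi> i (Poly_Mapping.lookup d' i) s t))"
      unfolding F_eq using d other by (intro sum.mono_neutral_right) auto
    thus ?thesis by (simp add: self C_def prod.distrib power_sum mult_ac)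
  qed
  from binary_forms_eqI[OF F_form this[symmetric]]
  have "(\<lambda>s t. C * (s ^ (\<Sum>i\<le>m. Poly_Mapping.lookup d i - e i) * t ^ (\<Sum>i\<le>m. e i))) \<in> binary_forms k" .
  moreover have "C \<noteq> 0"
    using d e(1) of_nat_choose_neq_0_iff_digit_le[OF p] by (auto simp: C_def in_keys_iff)
  ultimately have "red q (\<Sum>i\<le>m. Poly_Mapping.lookup d i - e i) + red q (\<Sum>i\<le>m. e i) = k"
    unfolding q_def using k by (intro monom_in_binary_formsD)
  \<comment> \<open>Since \<open>e\<close> vanishes at \<open>iota d\<close>, the exponent of
    \<open>s\<close> is positive; this sharpens the bound from \<open>k\<close> to
    \<open>k - 1\<close>.\<close>
  moreover have "red q (\<Sum>i\<le>m. Poly_Mapping.lookup d i - e i) \<noteq> 0"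
  proof -
    have "d \<in> simplex (m + 1) v"
      using f(1) d by (auto simp: hom_polys_def)
    hence "iota d \<le> m" "Poly_Mapping.lookup d (iota d) - e (iota d) \<noteq> 0"
      using iota_less[of d "m + 1" v] iota_lookup[OF simplex_neq_0] f(2) e(2) by auto
    thus ?thesis
      unfolding red_eq_0_iff[OF q2] by auto
  qed
  ultimately show ?thesis by (simp add: q_def)
qed

section \<open>Sufficiency of the digit condition\<close>

text \<open>The normalized case, in which the coordinate at \<open>iota d\<close> restricts to
  \<open>s\<close>. Every non-zero term of the expansion then has \<open>e (iota d) = 0\<close>, and
  Lucas puts \<open>e\<close> digitwise below \<open>d\<close>, so that \<open>le\<close> applies to
  it.\<close>

lemma iota_monom_lines_in_binary_forms:
  fixes a b :: "nat \<Rightarrow> 'a::{finite, field}"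
  assumes d: "d \<in> simplex (m + 1) v" and v: "0 < v"
    and vk: "v mod (CARD('a) - 1) = k mod (CARD('a) - 1)" and "0 < k"
    and p: "prime p" "CHAR('a) = p"
    and le: "\<And>e. (\<And>i. digit_le p (e i) (Poly_Mapping.lookup d i)) \<Longrightarrow> e (iota d) = 0 \<Longrightarrow>
      red CARD('a) (\<Sum>i\<le>m. e i) \<le> k - 1"
    and ab: "a (iota d) = 1" "b (iota d) = 0"
  shows "(\<lambda>s t. monom_eval d (\<lambda>i. a i * s + b i * t)) \<in> binary_forms k"
proof -
  define q where "q = CARD('a)"
  note q2 = card_field_ge2[where 'a = 'a, folded q_def]
  have dw: "weight d = v" "Poly_Mapping.keys d \<subseteq> {..m}"
    using d by (fastforce simp: simplex_def)+
  have iota: "iota d \<le> m" "Poly_Mapping.lookup d (iota d) \<noteq> 0"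
    using iota_less[OF d v] iota_lookup[OF simplex_neq_0[OF d v]] by auto
  let ?n = "Poly_Mapping.lookup d"
  have expand: "monom_eval d (\<lambda>i. a i * s + b i * t) = (\<Sum>e\<in>Pi\<^sub>E {..m} (\<lambda>i. {..?n i}).
      (\<Prod>i\<le>m. of_nat (?n i choose e i) * b i ^ e i * a i ^ (?n i - e i)) *
      (s ^ (\<Sum>i\<le>m. ?n i - e i) * t ^ (\<Sum>i\<le>m. e i)))" for s t
  proof -
    have "monom_eval d (\<lambda>i. a i * s + b i * t) = (\<Prod>i\<le>m. (b i * t + a i * s) ^ ?n i)"
      using dw by (subst monom_eval_superset[of "{..m}"]) (simp_all add: add.commute)
    also have "\<dots> = (\<Prod>i\<le>m. \<Sum>j\<le>?n i. (of_nat (?n i choose j) * b i ^ j * a i ^ (?n i - j)) *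
        (s ^ (?n i - j) * t ^ j))"
      by (simp add: binomial_ring power_mult_distrib mult_ac)
    also have "\<dots> = (\<Sum>e\<in>Pi\<^sub>E {..m} (\<lambda>i. {..?n i}). \<Prod>i\<le>m.
        (of_nat (?n i choose e i) * b i ^ e i * a i ^ (?n i - e i)) * (s ^ (?n i - e i) * t ^ e i))"
      by (rule prod_sum_PiE) auto
    finally show ?thesis
      by (simp add: prod.distrib power_sum)
  qed
  have summand: "(\<lambda>s t. (\<Prod>i\<le>m. of_nat (?n i choose e i) * b i ^ e i * a i ^ (?n i - e i)) *
      (s ^ (\<Sum>i\<le>m. ?n i - e i) * t ^ (\<Sum>i\<le>m. e i))) \<in> binary_forms k"
    (is "(\<lambda>s t. ?C * (s ^ ?X * t ^ ?Y)) \<in> _")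
    if e: "e \<in> Pi\<^sub>E {..m} (\<lambda>i. {..?n i})" for e
  proof (cases "?C = 0")
    case True
    show ?thesis unfolding True mult_zero_left by (rule binary_forms_0)
  next
    case False
    hence nz: "(of_nat (?n i choose e i) :: 'a) \<noteq> 0" "b i ^ e i \<noteq> 0" if "i \<le> m" for i
      using that by auto
    have "e (iota d) = 0"
      using nz(2)[OF iota(1)] ab by (cases "e (iota d)") auto
    \<comment> \<open>Outside \<open>{..m}\<close> the function \<open>e\<close> takes the value
      \<open>undefined\<close>; it is replaced by zero so that the digit condition holds at every
      index.\<close>
    define e' where "e' i = (if i \<le> m then e i else 0)" for i
    have Y: "?Y = (\<Sum>i\<le>m. e' i)"
      by (simp add: e'_def)
    define r where "r = red q ?Y"
    have r: "r \<le> k - 1"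
      unfolding r_def q_def Y
    proof (rule le)
      show "digit_le p (e' i) (?n i)" for i
        using nz(1) of_nat_choose_neq_0_iff_digit_le[OF p] by (auto simp: e'_def digit_le_def)
      show "e' (iota d) = 0" using \<open>e (iota d) = 0\<close> by (simp add: e'_def)
    qed
    have "?X \<noteq> 0"
      using iota \<open>e (iota d) = 0\<close> by (auto intro!: bexI[of _ "iota d"])
    have "?X + ?Y = v"
    proof -
      have "?X + ?Y = (\<Sum>i\<le>m. ?n i)"
        unfolding sum.distrib[symmetric] using e by (intro sum.cong) (auto simp: PiE_iff)
      thus ?thesis using weight_superset[of "{..m}" d] dw by simp
    qed
    hence "(?X + r) mod (q - 1) = k mod (q - 1)"
      using vk by (metis mod_add_right_eq q_def r_def red_mod)
    hence "[?X + r = (k - r) + r] (mod (q - 1))"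
      using r \<open>0 < k\<close> by (simp add: cong_def)
    hence "?X mod (q - 1) = (k - r) mod (q - 1)"
      by (simp add: cong_add_rcancel_nat) (simp add: cong_def)
    \<comment> \<open>Both exponents are positive: \<open>?X\<close> because of the entry at
      \<open>iota d\<close>, and \<open>k - r\<close> because \<open>r\<close> is at most
      \<open>k - 1\<close>. Hence the congruence gives equal powers even at
      \<open>s = 0\<close>.\<close>
    hence "s ^ ?X = s ^ (k - r)" for s :: 'a
      using \<open>?X \<noteq> 0\<close> r \<open>0 < k\<close> unfolding q_def by (intro power_eq_if_mod_eq) auto
    moreover have "t ^ ?Y = t ^ r" for t :: 'a
      unfolding r_def q_def power_red ..
    moreover have "(\<lambda>s t. ?C * (s ^ (k - r) * t ^ r)) \<in> binary_forms k"
      using r by (intro binary_forms_scale binary_forms_monom) auto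
    ultimately show ?thesis by simp
  qed
  show ?thesis
    unfolding expand by (rule binary_forms_sum) (rule summand)
qed

text \<open>If the linear form at \<open>iota d\<close> is non-zero, it becomes the first parameter
  of the line, which reduces to the normalized case. If it is zero, so is the monomial on the
  line.\<close>

lemma monom_lines_in_binary_forms:
  fixes a b :: "nat \<Rightarrow> 'a::{finite, field}"
  assumes d: "d \<in> simplex (m + 1) v" and v: "0 < v"
    and vk: "v mod (CARD('a) - 1) = k mod (CARD('a) - 1)" and "0 < k"
    and p: "prime p" "CHAR('a) = p"
    and le: "\<And>e. (\<And>i. digit_le p (e i) (Poly_Mapping.lookup d i)) \<Longrightarrow> e (iota d) = 0 \<Longrightarrow>
      red CARD('a) (\<Sum>i\<le>m. e i) \<le> k - 1"
  shows "(\<lambda>s t. monom_eval d (\<lambda>i. a i * s + b i * t)) \<in> binary_forms k"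
proof -
  note main = iota_monom_lines_in_binary_forms[OF d v vk \<open>0 < k\<close> p le]
  define \<alpha> \<beta> where "\<alpha> = a (iota d)" and "\<beta> = b (iota d)"
  consider "\<alpha> \<noteq> 0" | "\<alpha> = 0" "\<beta> \<noteq> 0" | "\<alpha> = 0" "\<beta> = 0" by blast
  thus ?thesis
  proof cases
    case 1
    \<comment> \<open>Solves \<open>a i * s + b i * t = a' i * (\<alpha> * s + \<beta> * t) + b' i *
      t\<close> for the new coefficients.\<close>
    define a' b' where "a' i = a i / \<alpha>" and "b' i = b i - a i * \<beta> / \<alpha>" for i
    have "(\<lambda>s t. monom_eval d (\<lambda>i. a' i * s + b' i * t)) \<in> binary_forms k"
      using 1 by (intro main) (auto simp: a'_def b'_def \<alpha>_def \<beta>_def)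
    from binary_forms_compose_linear[OF this, of \<alpha> \<beta> 0 1] show ?thesis
    proof (rule binary_forms_eqI)
      fix s t
      have "a' i * (\<alpha> * s + \<beta> * t) + b' i * (0 * s + 1 * t) = a i * s + b i * t" for i
        using 1 by (simp add: a'_def b'_def field_simps)
      thus "monom_eval d (\<lambda>i. a i * s + b i * t) =
          monom_eval d (\<lambda>i. a' i * (\<alpha> * s + \<beta> * t) + b' i * (0 * s + 1 * t))" by simp
    qed
  next
    case 2
    \<comment> \<open>The form at \<open>iota d\<close> is \<open>\<beta> * t\<close>, so the two
      parameters exchange their roles.\<close>
    define b' where "b' i = b i / \<beta>" for i
    have "(\<lambda>s t. monom_eval d (\<lambda>i. b' i * s + a i * t)) \<in> binary_forms k"
      using 2 by (intro main) (auto simp: b'_def \<alpha>_def \<beta>_def)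
    from binary_forms_compose_linear[OF this, of 0 \<beta> 1 0] show ?thesis
      using 2 by (simp add: b'_def add.commute)
  next
    case 3
    have "d \<noteq> 0" using simplex_neq_0[OF d v] .
    hence "iota d \<in> Poly_Mapping.keys d"
      using iota_lookup by (simp add: in_keys_iff)
    hence "monom_eval d (\<lambda>i. a i * s + b i * t) = 0" for s t
      unfolding monom_eval_def using 3 iota_lookup[OF \<open>d \<noteq> 0\<close>]
      by (intro prod_zero) (auto intro!: bexI[of _ "iota d"] simp: \<alpha>_def \<beta>_def)
    thus ?thesis using binary_forms_0 by simp
  qed
qed

section \<open>The digit condition on \<open>eta d\<close> as a condition on full tuples\<close>

lemma lookup_eta: "Poly_Mapping.lookup (eta d) i = Poly_Mapping.lookup d (iota d + 1 + i)"
  unfolding eta_def by (subst map_key.rep_eq) (auto intro: injI)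

lemma weight_shift:
  assumes "\<And>i. Poly_Mapping.lookup e' i = e (l + 1 + i)" "\<And>i. i \<le> l \<Longrightarrow> e i = 0" "\<And>i. m < i \<Longrightarrow> e i = 0"
  shows "weight e' = (\<Sum>i\<le>m. e i)"
proof -
  have "Poly_Mapping.keys e' \<subseteq> {..m}"
  proof
    fix i assume "i \<in> Poly_Mapping.keys e'"
    hence "e (l + 1 + i) \<noteq> 0" by (simp add: in_keys_iff assms(1))
    thus "i \<in> {..m}" using assms(3)[of "l + 1 + i"] by (cases "i \<le> m") auto
  qed
  hence "weight e' = (\<Sum>i\<in>{0..m}. e (i + (l + 1)))"
    by (subst weight_superset[of "{0..m}"]) (auto simp: assms(1) ac_simps)
  also have "\<dots> = (\<Sum>i\<in>{0 + (l + 1)..m + (l + 1)}. e i)"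
    by (rule sum.shift_bounds_cl_nat_ivl[symmetric])
  also have "\<dots> = (\<Sum>i\<le>m + (l + 1). e i)"
    by (intro sum.mono_neutral_left) (auto simp: assms(2))
  also have "\<dots> = (\<Sum>i\<le>m. e i)"
    by (intro sum.mono_neutral_right) (auto simp: assms(3))
  finally show ?thesis .
qed

text \<open>Shifting indices matches the tuples digitwise below \<open>eta d\<close> with those
  below \<open>d\<close> that vanish at \<open>iota d\<close>: left of \<open>iota d\<close> and
  beyond \<open>m\<close> the entries of \<open>d\<close> are zero and force zeros.\<close>

lemma eta_condition_iff:
  assumes d: "d \<in> simplex (m + 1) v" and p: "2 \<le> p"
  shows "(\<forall>e. exps_digit_le p e (eta d) \<longrightarrow> P (weight e)) \<longleftrightarrow>
    (\<forall>e. (\<forall>i. digit_le p (e i) (Poly_Mapping.lookup d i)) \<and> e (iota d) = 0 \<longrightarrow> P (\<Sum>i\<le>m. e i))"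
proof -
  have zero: "Poly_Mapping.lookup d i = 0" if "m < i" for i
    using d that by (force simp: simplex_def simp flip: not_in_keys_iff_lookup_eq_zero)
  have digit_0: "digit_le p x 0 \<Longrightarrow> x = 0" for x
    using digit_le_imp_le[OF p, of x 0] by simp
  show ?thesis
  proof (intro iffI allI impI)
    fix e :: "nat \<Rightarrow> nat"
    assume *: "\<forall>e. exps_digit_le p e (eta d) \<longrightarrow> P (weight e)"
      and e: "(\<forall>i. digit_le p (e i) (Poly_Mapping.lookup d i)) \<and> e (iota d) = 0"
    have e0: "e i = 0" if "i \<le> iota d \<or> m < i" for i
      using that e digit_0[of "e i"] zero[of i] less_iota_lookup[of i d]
      by (metis le_neq_implies_less)
    define e' where "e' = Abs_poly_mapping (\<lambda>i. e (iota d + 1 + i))"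
    have "finite {i. e (iota d + 1 + i) \<noteq> 0}"
    proof (rule finite_subset)
      show "{i. e (iota d + 1 + i) \<noteq> 0} \<subseteq> {..m}"
      proof
        fix i assume "i \<in> {i. e (iota d + 1 + i) \<noteq> 0}"
        thus "i \<in> {..m}" using e0[of "iota d + 1 + i"] by (cases "i \<le> m") auto
      qed
    qed simp
    hence lookup: "Poly_Mapping.lookup e' i = e (iota d + 1 + i)" for i
      by (simp add: e'_def)
    have "exps_digit_le p e' (eta d)"
      using e by (simp add: exps_digit_le_def lookup lookup_eta)
    hence "P (weight e')" using * by blast
    thus "P (\<Sum>i\<le>m. e i)"
      using weight_shift[of e' e "iota d" m] lookup e0 by simp
  next
    fix e
    assume *: "\<forall>e. (\<forall>i. digit_le p (e i) (Poly_Mapping.lookup d i)) \<and> e (iota d) = 0 \<longrightarrow> P (\<Sum>i\<le>m. e i)"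
      and e: "exps_digit_le p e (eta d)"
    define e' where "e' i = (if i \<le> iota d then 0 else Poly_Mapping.lookup e (i - iota d - 1))" for i
    have digit: "digit_le p (e' i) (Poly_Mapping.lookup d i)" for i
    proof (cases "i \<le> iota d")
      case False
      hence "Poly_Mapping.lookup d i = Poly_Mapping.lookup (eta d) (i - iota d - 1)"
        by (simp add: lookup_eta)
      thus ?thesis using e False by (simp add: e'_def exps_digit_le_def)
    qed (simp add: e'_def digit_le_def)
    have "weight e = (\<Sum>i\<le>m. e' i)"
    proof (rule weight_shift)
      show "e' i = 0" if "m < i" for i
        using digit[of i] zero[OF that] digit_0 by simp
    qed (auto simp: e'_def)
    thus "P (weight e)"
      using *[THEN spec, of e'] digit by (simp add: e'_def)
  qed
qed

section \<open>The degree set\<close>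

text \<open>Replace each monomial by its reduction, which is the same function. Distinct monomials
  may merge, hence the sum of singles.\<close>

lemma P_reduced_representative:
  fixes f :: "'a::{finite, field} mpol"
  assumes f: "f \<in> hom_polys m v"
  obtains g where "g \<in> hom_polys m v" "\<And>d. d \<in> Poly_Mapping.keys g \<Longrightarrow> P_reduced CARD('a) d"
    "\<And>x. poly_eval g x = poly_eval f x"
proof -
  define g where "g = (\<Sum>d\<in>Poly_Mapping.keys f.
    Poly_Mapping.single (P_reduction CARD('a) d) (Poly_Mapping.lookup f d))"
  have "Poly_Mapping.keys g \<subseteq> {d \<in> simplex (m + 1) v. P_reduced CARD('a) d}"
    unfolding g_def
  proof (rule keys_sum_subset)
    fix d assume "d \<in> Poly_Mapping.keys f"
    hence "d \<in> simplex (m + 1) v" using f by (auto simp: hom_polys_def)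
    thus "Poly_Mapping.keys (Poly_Mapping.single (P_reduction CARD('a) d) (Poly_Mapping.lookup f d))
        \<subseteq> {d \<in> simplex (m + 1) v. P_reduced CARD('a) d}"
      using P_reduction_in_simplex[OF card_field_ge2[where 'a = 'a]]
        P_reduction(1)[OF card_field_ge2[where 'a = 'a]] by (auto simp: keys_single)
  qed
  moreover have "poly_eval g x = poly_eval f x" for x
    by (simp add: g_def poly_eval_sum poly_eval_single monom_eval_P_reduction poly_eval_keys[of f])
  ultimately show ?thesis using that by (auto simp: hom_polys_def)
qed

text \<open>Applied in both directions it gives uniqueness of the degree set. The monomial of
  \<open>d\<close> agrees at all points with some \<open>g\<close> supported in \<open>E\<close>;
  their difference is reduced, so it vanishes as a polynomial.\<close>

lemma P_reduced_degree_set_mono: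
  fixes D E :: "exps set"
  assumes D: "D \<subseteq> {d \<in> simplex (m + 1) v. P_reduced CARD('a) d}"
    and E: "E \<subseteq> {d \<in> simplex (m + 1) v. P_reduced CARD('a) d}" and v: "0 < v"
    and sub: "ev m ` Defs.Poly D \<subseteq> (ev m ` Defs.Poly E :: ((nat \<Rightarrow> 'a::{finite, field}) set \<Rightarrow> 'a) set)"
  shows "D \<subseteq> E"
proof
  fix d assume d: "d \<in> D"
  let ?f = "Poly_Mapping.single d 1 :: 'a mpol"
  have "?f \<in> Defs.Poly D" using d by (simp add: Poly_eq)
  hence "ev m ?f \<in> ev m ` Defs.Poly E" using sub by blast
  then obtain g :: "'a mpol" where g: "ev m ?f = ev m g" "Poly_Mapping.keys g \<subseteq> E"
    by (auto simp: Poly_eq)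
  have hom: "?f \<in> hom_polys m v" "g \<in> hom_polys m v"
    using d D E g by (auto simp: hom_polys_def)
  have "?f - g = 0"
  proof (rule P_reduced_poly_eq_0[OF _ v])
    have keys: "Poly_Mapping.keys (?f - g) \<subseteq> D \<union> E"
      using d g by (auto simp: in_keys_iff lookup_minus lookup_single when_def split: if_splits)
    thus "?f - g \<in> hom_polys m v"
      using D E by (auto simp: hom_polys_def)
    show "P_reduced CARD('a) e" if "e \<in> Poly_Mapping.keys (?f - g)" for e
      using that keys D E by blast
    show "poly_eval (?f - g) x = 0" if "x \<in> vecs (m + 1) - {\<lambda>_. 0}" for x
      using g(1) that ev_eq_iff[OF poly_eval_homogeneous[OF hom(1)] poly_eval_homogeneous[OF hom(2)], of m]
      by (simp add: poly_eval_diff)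
  qed
  hence "g = ?f" by simp
  thus "d \<in> E" using g(2) by simp
qed

theorem corollary29:
  fixes p s q m k v :: nat
  assumes "prime p" and "s \<ge> 1" and "q = p ^ s" and "CARD('a::{finite, field}) = q"
    and "m \<ge> 2" and "1 \<le> k" and "k \<le> q - 1"
    and "v = k + (m - 1) * (q - 1)"
  shows "PDeg TYPE('a) m k =
    {P_reduction q d | d. d \<in> simplex (m + 1) v \<and>
       (\<forall>e. exps_digit_le p e (eta (P_reduction q d)) \<longrightarrow> red q (weight e) \<le> k - 1)}"
proof -
  have q: "q = CARD('a)" and q2: "2 \<le> q"
    using assms(4) card_field_ge2[where 'a = 'a] by auto
  have v: "0 < v" "0 < k" "v mod (CARD('a) - 1) = k mod (CARD('a) - 1)" and k: "k < CARD('a)"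
    using assms(6-8) q2 by (auto simp: q)
  have p: "prime p" "CHAR('a) = p" "2 \<le> p"
    using assms CHAR_eq_prime prime_ge_2_nat by auto
  define D where "D = {d \<in> simplex (m + 1) v. P_reduced q d \<and>
    (\<forall>e. exps_digit_le p e (eta d) \<longrightarrow> red q (weight e) \<le> k - 1)}"
  \<comment> \<open>Reduced tuples are their own reductions, so the reductions in question are just
    the reduced tuples with the digit property.\<close>
  have RHS: "{P_reduction q d | d. d \<in> simplex (m + 1) v \<and>
      (\<forall>e. exps_digit_le p e (eta (P_reduction q d)) \<longrightarrow> red q (weight e) \<le> k - 1)} = D"
    (is "?R = D")
  proof
    show "?R \<subseteq> D"
      using P_reduction(1)[OF q2] P_reduction_in_simplex[OF q2] by (auto simp: D_def)
    show "D \<subseteq> ?R"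
    proof
      fix d assume "d \<in> D"
      moreover from this have "P_reduction q d = d"
        using P_reduction_eq_self[OF q2] by (simp add: D_def)
      ultimately show "d \<in> ?R"
        by (auto simp: D_def intro!: exI[of _ d])
    qed
  qed
  have D_sub: "D \<subseteq> {d \<in> simplex (m + 1) v. P_reduced CARD('a) d}"
    by (auto simp: D_def q)
  have "(PLift m k :: ((nat \<Rightarrow> 'a) set \<Rightarrow> 'a) set) = {ev m f | f. f \<in> hom_polys m v \<and>
      (\<forall>a b. (\<lambda>s t. poly_eval f (\<lambda>i. a i * s + b i * t)) \<in> binary_forms k)}"
    unfolding PLift_def assms(4) assms(8)[symmetric]
    by (intro Collect_cong ex_cong1 conj_cong refl restrict_lines_iff[OF _ v])
  also have "\<dots> = ev m ` Defs.Poly D"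
  proof (intro equalityI subsetI)
    fix c assume "c \<in> {ev m f | f :: 'a mpol. f \<in> hom_polys m v \<and>
      (\<forall>a b. (\<lambda>s t. poly_eval f (\<lambda>i. a i * s + b i * t)) \<in> binary_forms k)}"
    then obtain f :: "'a mpol" where f: "c = ev m f" "f \<in> hom_polys m v"
      "\<And>a b. (\<lambda>s t. poly_eval f (\<lambda>i. a i * s + b i * t)) \<in> binary_forms k" by blast
    \<comment> \<open>Necessity needs reduced exponents, so \<open>f\<close> is replaced by a
      reduced polynomial with the same values.\<close>
    obtain g where g: "g \<in> hom_polys m v" "\<And>d. d \<in> Poly_Mapping.keys g \<Longrightarrow> P_reduced CARD('a) d"
      "\<And>x. poly_eval g x = poly_eval f x"
      using P_reduced_representative[OF f(2)] by blast
    have "Poly_Mapping.keys g \<subseteq> D"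
    proof
      fix d assume d: "d \<in> Poly_Mapping.keys g"
      hence d': "d \<in> simplex (m + 1) v" using g(1) by (auto simp: hom_polys_def)
      have "\<forall>e. (\<forall>i. digit_le p (e i) (Poly_Mapping.lookup d i)) \<and> e (iota d) = 0 \<longrightarrow>
          red q (\<Sum>i\<le>m. e i) \<le> k - 1"
        unfolding q
        using P_reduced_lines_imp_red_le[OF g(1) v(1) g(2) _ k p(1,2) d] f(3) by (simp add: g(3))
      thus "d \<in> D"
        using d' g(2)[OF d] eta_condition_iff[OF d' p(3), of "\<lambda>w. red q w \<le> k - 1"]
        by (simp add: D_def q)
    qed
    moreover have "c = ev m g"
      unfolding f(1) by (rule ev_cong) (simp add: g(3))
    ultimately show "c \<in> ev m ` Defs.Poly D" by (auto simp: Poly_eq)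
  next
    fix c :: "(nat \<Rightarrow> 'a) set \<Rightarrow> 'a" assume "c \<in> ev m ` Defs.Poly D"
    then obtain f :: "'a mpol" where f: "c = ev m f" "Poly_Mapping.keys f \<subseteq> D"
      by (auto simp: Poly_eq)
    have "(\<lambda>s t. poly_eval f (\<lambda>i. a i * s + b i * t)) \<in> binary_forms k" for a b
      unfolding poly_eval_keys[of f]
    \<comment> \<open>The condition on lines is linear in \<open>f\<close>, so monomials
      suffice.\<close>
    proof (intro binary_forms_sum binary_forms_scale)
      fix d assume "d \<in> Poly_Mapping.keys f"
      hence d: "d \<in> simplex (m + 1) v"
        "\<forall>e. exps_digit_le p e (eta d) \<longrightarrow> red q (weight e) \<le> k - 1"
        using f(2) by (auto simp: D_def)
      show "(\<lambda>s t. monom_eval d (\<lambda>i. a i * s + b i * t)) \<in> binary_forms k"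
      proof (rule monom_lines_in_binary_forms[OF d(1) v(1,3,2) p(1,2)])
        fix e assume "\<And>i. digit_le p (e i) (Poly_Mapping.lookup d i)" "e (iota d) = 0"
        thus "red CARD('a) (\<Sum>i\<le>m. e i) \<le> k - 1"
          using d(2)[unfolded eta_condition_iff[OF d(1) p(3), of "\<lambda>w. red q w \<le> k - 1"]]
          by (simp add: q)
      qed
    qed
    moreover have "f \<in> hom_polys m v"
      using f(2) by (auto simp: hom_polys_def D_def)
    ultimately show "c \<in> {ev m f | f :: 'a mpol. f \<in> hom_polys m v \<and>
      (\<forall>a b. (\<lambda>s t. poly_eval f (\<lambda>i. a i * s + b i * t)) \<in> binary_forms k)}"
      using f(1) by blast
  qed
  finally have PLift: "(PLift m k :: ((nat \<Rightarrow> 'a) set \<Rightarrow> 'a) set) = ev m ` Defs.Poly D" .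
  have "PDeg TYPE('a) m k = D"
    unfolding PDeg_def assms(4) assms(8)[symmetric]
  proof (rule the_equality)
    show "D \<subseteq> simplex (m + 1) v \<and> (\<forall>d\<in>D. P_reduced q d) \<and>
        (PLift m k :: ((nat \<Rightarrow> 'a) set \<Rightarrow> 'a) set) = ev m ` Defs.Poly D"
      using PLift by (auto simp: D_def)
  next
    fix E assume E: "E \<subseteq> simplex (m + 1) v \<and> (\<forall>d\<in>E. P_reduced q d) \<and>
        (PLift m k :: ((nat \<Rightarrow> 'a) set \<Rightarrow> 'a) set) = ev m ` Defs.Poly E"
    hence E_sub: "E \<subseteq> {d \<in> simplex (m + 1) v. P_reduced CARD('a) d}"
      by (auto simp: q)
    have eq: "ev m ` Defs.Poly E = (ev m ` Defs.Poly D :: ((nat \<Rightarrow> 'a) set \<Rightarrow> 'a) set)"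
      using E PLift by simp
    show "E = D"
      using P_reduced_degree_set_mono[OF E_sub D_sub v(1)] P_reduced_degree_set_mono[OF D_sub E_sub v(1)] eq
      by blast
  qed
  thus ?thesis using RHS by simp
qed

end
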